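(* Let $k$ be a field of characteristic $0$, let $n\ge 3$, and let $F=a_0p_1^3+a_1np_1p_2+a_2n^2p_3\in k[X_1,\dots,X_n]$ be the symmetric cubic form at the point $(a_0:a_1:a_2)\in\mathbb P^2$. Then the Waring rank of $F$ is (where cases overlap, the one listed first applies) \[ wr(F)=\begin{cases} 1&\text{at }\mathcal P=(1:0:0);\\ n-1&\text{at }\mathcal Q=(2:-3:1)\text{ if }n=3;\\ n&\text{at }\mathcal C\setminus\{\mathcal P\}\text{ and, if }n=3,\text{ also at }\ell_1\setminus\{\mathcal Q\};\\ 2(n-1)&\text{at }\ell_2\setminus\{\mathcal P\};\\ n+1&\text{otherwise.} \end{cases} \]
   Context: $p_i=\sum_{j=1}^nX_j^i$ are the power sums; every symmetric cubic form in $k[X_1,\dots,X_n]$ can be written as $a_0p_1^3+a_1np_1p_2+a_2n^2p_3$, and symmetric cubics up to scalar are identified with points $(a_0:a_1:a_2)\in\mathbb P^2$. $\mathcal C\subset\mathbb P^2$ is the image of $\mathbb P^1\to\mathbb P^2$, $(\alpha:\beta)\mapsto(3\alpha\beta^2+\beta^3:3\alpha^2\beta:\alpha^3)$. $\ell_1$ is the line $a_1+3a_2=0$ and $\ell_2$ is the line $a_2=0$ in $\mathbb P^2$. The Waring rank $wr(F)$ of a form $F$ of degree $m$ is the smallest $r$ such that $F$ can be written as $L_1^m+\cdots+L_r^m$ for linear forms $L_1,\dots,L_r$.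
   Formalization: The Waring rank is taken with linear forms over an algebraic closure of k; with linear forms over k itself the claim fails, e.g. over the rationals 2p_1^3 at P is not a cube of a linear form. *)

theory Defs
  imports "HOL-Algebra.Algebraic_Closure_Type" "HOL-Library.Poly_Mapping"
begin

text \<open>
  Polynomials in variables indexed by \<^typ>\<open>nat\<close>: finitely supported maps from
  monomials (finitely supported exponent maps) to coefficients, with the convolution
  product of \<^theory>\<open>HOL-Library.Poly_Mapping\<close>. The ring $k[X_1,\dots,X_n]$
  uses the variables with indices in \<^term>\<open>{1..n}\<close>.
\<close>

type_synonym 'a mpoly = "(nat \<Rightarrow>\<^sub>0 nat) \<Rightarrow>\<^sub>0 'a"

definition Var :: "nat \<Rightarrow> 'a::comm_ring_1 mpoly" where
  "Var j = Poly_Mapping.single (Poly_Mapping.single j 1) 1"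

definition Const :: "'a::comm_ring_1 \<Rightarrow> 'a mpoly" where
  "Const c = Poly_Mapping.single 0 c"

definition base_change :: "('a::field \<Rightarrow> 'b::field) \<Rightarrow> 'a mpoly \<Rightarrow> 'b mpoly" where
  "base_change \<phi> F = Poly_Mapping.map \<phi> F"

definition power_sum :: "nat \<Rightarrow> nat \<Rightarrow> 'a::comm_ring_1 mpoly" where
  "power_sum n i = (\<Sum>j=1..n. Var j ^ i)"

definition symmetric_cubic :: "nat \<Rightarrow> 'a::comm_ring_1 \<times> 'a \<times> 'a \<Rightarrow> 'a mpoly" where
  "symmetric_cubic n = (\<lambda>(a0, a1, a2).
     Const a0 * power_sum n 1 ^ 3
     + Const (a1 * of_nat n) * power_sum n 1 * power_sum n 2
     + Const (a2 * of_nat n ^ 2) * power_sum n 3)"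

definition linear_form :: "nat \<Rightarrow> 'a::comm_ring_1 mpoly \<Rightarrow> bool" where
  "linear_form n L \<longleftrightarrow> (\<exists>c. L = (\<Sum>j=1..n. Const (c j) * Var j))"

definition waring_rank :: "nat \<Rightarrow> nat \<Rightarrow> 'a::field mpoly \<Rightarrow> nat" where
  "waring_rank n m F =
     (LEAST r. \<exists>L. (\<forall>i\<in>{1..r}. linear_form n (L i)) \<and> F = (\<Sum>i=1..r. L i ^ m))"

text \<open>
  The rank of a form over \<^typ>\<open>'a\<close> is taken geometrically: the linear forms have
  coefficients in an algebraic closure. With linear forms over the ground field the rank
  of a cubic would depend on more than its point in the projective plane: over the
  rationals, $2p_1^3$ is not the cube of a linear form; and over the reals, for $n=3$, the form
  at $(2:-3:1)$ is a product of three distinct real linear forms, hence not a sum of two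
  real cubes.
\<close>

definition geometric_waring_rank :: "nat \<Rightarrow> nat \<Rightarrow> 'a::field mpoly \<Rightarrow> nat" where
  "geometric_waring_rank n m F = waring_rank n m (base_change to_ac F)"

text \<open>
  A point of the projective plane is the set of all its homogeneous coordinate vectors;
  \<open>proj_pt v\<close> is a point only for \<open>v \<noteq> (0, 0, 0)\<close>.
\<close>

definition proj_pt :: "'a::field \<times> 'a \<times> 'a \<Rightarrow> ('a \<times> 'a \<times> 'a) set" where
  "proj_pt = (\<lambda>(a0, a1, a2). {(c * a0, c * a1, c * a2) | c. c \<noteq> 0})"

definition pt_P :: "('a::field \<times> 'a \<times> 'a) set" where
  "pt_P = proj_pt (1, 0, 0)"

definition pt_Q :: "('a::field \<times> 'a \<times> 'a) set" where
  "pt_Q = proj_pt (2, -3, 1)"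

definition curve_C :: "('a::field \<times> 'a \<times> 'a) set set" where
  "curve_C = {proj_pt (3 * \<alpha> * \<beta>^2 + \<beta>^3, 3 * \<alpha>^2 * \<beta>, \<alpha>^3) | \<alpha> \<beta>. (\<alpha>, \<beta>) \<noteq> (0, 0)}"

definition line_1 :: "('a::field \<times> 'a \<times> 'a) set set" where
  "line_1 = {proj_pt (a0, a1, a2) | a0 a1 a2. (a0, a1, a2) \<noteq> (0, 0, 0) \<and> a1 + 3 * a2 = 0}"

definition line_2 :: "('a::field \<times> 'a \<times> 'a) set set" where
  "line_2 = {proj_pt (a0, a1, a2) | a0 a1 a2. (a0, a1, a2) \<noteq> (0, 0, 0) \<and> a2 = 0}"

end

theory Submission
  imports Defs
begin

text \<open>
  Polarizing a decomposition \<open>F = \<Sum>\<^sub>i L\<^sub>i\<^sup>3\<close> gives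
  \<open>T(u, v, w) = \<Sum>\<^sub>i L\<^sub>i(u) L\<^sub>i(v) L\<^sub>i(w)\<close> for the symmetric trilinear form \<open>T\<close> of \<open>F\<close>.

  If \<open>a\<^sub>2 \<noteq> 0\<close>, put \<open>b = a\<^sub>1 / (3 a\<^sub>2)\<close>, \<open>e = a\<^sub>0 - a\<^sub>2 (3 b\<^sup>2 + b\<^sup>3)\<close> and
  \<open>y\<^sub>j = n X\<^sub>j + b p\<^sub>1\<close>; then \<open>F = (a\<^sub>2 / n) \<Sum>\<^sub>j y\<^sub>j\<^sup>3 + e p\<^sub>1\<^sup>3\<close>, so that the rank is at most \<open>n + 1\<close>,
  and at most \<open>n\<close> on the curve \<open>e = 0\<close>. Unless \<open>e = 0\<close> and \<open>b = -1\<close> (the point \<open>Q\<close>), \<open>T\<close> is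
  nondegenerate and the rank is at least \<open>n\<close>; it is exactly \<open>n\<close> only if \<open>T\<close> is diagonal in the basis
  dual to the \<open>L\<^sub>i\<close>, which is impossible for \<open>e \<noteq> 0\<close> except when \<open>n = 3\<close> and \<open>b = -1\<close>.
  Since adding \<open>p\<^sub>1\<^sup>3\<close> raises the rank by at most one, this also bounds the rank at \<open>Q\<close> from below.

  If \<open>a\<^sub>2 = 0\<close>, then \<open>F\<close> is \<open>p\<^sub>1\<close> times a quadratic form that is nondegenerate on \<open>p\<^sub>1 = 0\<close>.
  Diagonalizing the latter splits \<open>F\<close> into \<open>n - 1\<close> binary cubics of rank two. Conversely, some point \<open>w\<close>
  with \<open>p\<^sub>1(w) = 1\<close> is a zero of at least \<open>n - 1\<close> of the \<open>L\<^sub>i\<close>, while \<open>T(w, \<cdot>, \<cdot>)\<close> has rank \<open>n - 1\<close>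
  on \<open>p\<^sub>1 = 0\<close>, which takes \<open>n - 1\<close> further \<open>L\<^sub>i\<close>.
\<close>

section \<open>Evaluation and base change\<close>

lemma poly_mapping_eq_sum_single:
  fixes F :: "'a \<Rightarrow>\<^sub>0 'b::comm_monoid_add"
  shows "F = (\<Sum>m\<in>Poly_Mapping.keys F. Poly_Mapping.single m (Poly_Mapping.lookup F m))"
proof (rule poly_mapping_eqI)
  fix k
  show "Poly_Mapping.lookup F k =
    Poly_Mapping.lookup (\<Sum>m\<in>Poly_Mapping.keys F. Poly_Mapping.single m (Poly_Mapping.lookup F m)) k"
    by (auto simp: Poly_Mapping.lookup_sum lookup_single when_def in_keys_iff)
qed

lemma additive_sum:
  fixes h :: "'a::ab_group_add \<Rightarrow> 'b::ab_group_add"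
  assumes "\<And>F G. h (F + G) = h F + h G"
  shows "h (sum f A) = (\<Sum>i\<in>A. h (f i))"
proof -
  have "h 0 = 0" using assms[of 0 0] by simp
  then show ?thesis
    by (induction A rule: infinite_finite_induct) (simp_all add: assms)
qed

text \<open>Both factors are sums of monomials, so additivity reduces multiplicativity to products
  of two monomials. Serves for evaluation and for base change alike.\<close>

lemma additive_mult_hom:
  fixes h :: "'a::comm_ring_1 mpoly \<Rightarrow> 'b::comm_ring_1"
  assumes add: "\<And>F G. h (F + G) = h F + h G"
    and single: "\<And>m m' c c'. h (Poly_Mapping.single m c * Poly_Mapping.single m' c') =
      h (Poly_Mapping.single m c) * h (Poly_Mapping.single m' c')"
  shows "h (F * G) = h F * h G"
proof -
  let ?s = "\<lambda>F m. Poly_Mapping.single m (Poly_Mapping.lookup F m)"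
  have "h (F * G) = h (sum (?s F) (Poly_Mapping.keys F) * sum (?s G) (Poly_Mapping.keys G))"
    using poly_mapping_eq_sum_single[of F] poly_mapping_eq_sum_single[of G] by metis
  also have "\<dots> = (\<Sum>m\<in>Poly_Mapping.keys F. h (?s F m)) * (\<Sum>m\<in>Poly_Mapping.keys G. h (?s G m))"
    by (simp add: sum_product additive_sum[of h, OF add] single)
  also have "\<dots> = h F * h G"
    using poly_mapping_eq_sum_single[of F] poly_mapping_eq_sum_single[of G]
    by (metis additive_sum[of h, OF add])
  finally show ?thesis .
qed

lemma multiplicative_power:
  fixes h :: "'a::comm_ring_1 \<Rightarrow> 'b::comm_ring_1"
  assumes "\<And>F G. h (F * G) = h F * h G" and "h 1 = 1"
  shows "h (F ^ k) = h F ^ k"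
  by (induction k) (simp_all add: assms)

lemma Const_1: "Const 1 = 1"
  by (simp add: Const_def)

definition monom_eval :: "(nat \<Rightarrow> 'a::comm_ring_1) \<Rightarrow> (nat \<Rightarrow>\<^sub>0 nat) \<Rightarrow> 'a" where
  "monom_eval x m = (\<Prod>j\<in>Poly_Mapping.keys m. x j ^ Poly_Mapping.lookup m j)"

definition mpoly_eval :: "(nat \<Rightarrow> 'a::comm_ring_1) \<Rightarrow> 'a mpoly \<Rightarrow> 'a" where
  "mpoly_eval x F = (\<Sum>m\<in>Poly_Mapping.keys F. Poly_Mapping.lookup F m * monom_eval x m)"

lemma monom_eval_superset:
  assumes "finite A" "Poly_Mapping.keys m \<subseteq> A"
  shows "monom_eval x m = (\<Prod>j\<in>A. x j ^ Poly_Mapping.lookup m j)"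
  unfolding monom_eval_def
  by (rule prod.mono_neutral_left) (use assms in \<open>auto simp: in_keys_iff\<close>)

lemma monom_eval_add: "monom_eval x (m + m') = monom_eval x m * monom_eval x m'"
proof -
  let ?A = "Poly_Mapping.keys m \<union> Poly_Mapping.keys m'"
  have "monom_eval x (m + m') = (\<Prod>j\<in>?A. x j ^ Poly_Mapping.lookup (m + m') j)"
    by (rule monom_eval_superset) (simp_all add: keys_add)
  also have "\<dots> = (\<Prod>j\<in>?A. x j ^ Poly_Mapping.lookup m j) * (\<Prod>j\<in>?A. x j ^ Poly_Mapping.lookup m' j)"
    by (simp add: lookup_add power_add prod.distrib)
  also have "\<dots> = monom_eval x m * monom_eval x m'"
    by (simp add: monom_eval_superset[of ?A])
  finally show ?thesis .
qed

lemma mpoly_eval_superset: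
  assumes "finite A" "Poly_Mapping.keys F \<subseteq> A"
  shows "mpoly_eval x F = (\<Sum>m\<in>A. Poly_Mapping.lookup F m * monom_eval x m)"
  unfolding mpoly_eval_def
  by (rule sum.mono_neutral_left) (use assms in \<open>auto simp: in_keys_iff\<close>)

lemma mpoly_eval_add: "mpoly_eval x (F + G) = mpoly_eval x F + mpoly_eval x G"
proof -
  let ?A = "Poly_Mapping.keys F \<union> Poly_Mapping.keys G"
  have "mpoly_eval x (F + G) = (\<Sum>m\<in>?A. Poly_Mapping.lookup (F + G) m * monom_eval x m)"
    by (rule mpoly_eval_superset) (simp_all add: keys_add)
  also have "\<dots> = mpoly_eval x F + mpoly_eval x G"
    by (simp add: lookup_add distrib_right sum.distrib mpoly_eval_superset[of ?A])
  finally show ?thesis .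
qed

lemma mpoly_eval_single: "mpoly_eval x (Poly_Mapping.single m c) = c * monom_eval x m"
  by (simp add: mpoly_eval_def)

lemma mpoly_eval_mult: "mpoly_eval x (F * G) = mpoly_eval x F * mpoly_eval x G"
  by (rule additive_mult_hom)
    (simp_all add: mpoly_eval_add mult_single mpoly_eval_single monom_eval_add algebra_simps)

lemma mpoly_eval_Const: "mpoly_eval x (Const c) = c"
  by (simp add: Const_def mpoly_eval_single monom_eval_def)

lemma mpoly_eval_Var: "mpoly_eval x (Var j) = x j"
  by (simp add: Var_def mpoly_eval_single monom_eval_def)

lemma mpoly_eval_sum: "mpoly_eval x (sum f A) = (\<Sum>i\<in>A. mpoly_eval x (f i))"
  by (rule additive_sum) (rule mpoly_eval_add)

lemma mpoly_eval_power: "mpoly_eval x (F ^ k) = mpoly_eval x F ^ k"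
  by (rule multiplicative_power) (simp_all add: mpoly_eval_mult mpoly_eval_Const flip: Const_1)

lemmas mpoly_eval_simps =
  mpoly_eval_add mpoly_eval_mult mpoly_eval_Const mpoly_eval_Var mpoly_eval_sum mpoly_eval_power

lemma mpoly_eval_symmetric_cubic:
  "mpoly_eval x (symmetric_cubic n (a0, a1, a2)) =
    a0 * (\<Sum>j=1..n. x j) ^ 3 + a1 * of_nat n * (\<Sum>j=1..n. x j) * (\<Sum>j=1..n. x j ^ 2)
    + a2 * of_nat n ^ 2 * (\<Sum>j=1..n. x j ^ 3)"
  by (simp add: symmetric_cubic_def power_sum_def mpoly_eval_simps)

text \<open>\<open>Poly_Mapping.map\<close> acts only on the support; since
  \<open>to_ac 0 = 0\<close>, the formula holds at every monomial.\<close>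

lemma lookup_base_change_to_ac:
  "Poly_Mapping.lookup (base_change to_ac F) m = to_ac (Poly_Mapping.lookup F m)"
  by (simp add: base_change_def Poly_Mapping.map.rep_eq when_def)

lemma base_change_to_ac_add:
  "base_change to_ac (F + G) = base_change to_ac F + base_change to_ac G"
  by (rule poly_mapping_eqI) (simp add: lookup_base_change_to_ac lookup_add)

lemma base_change_to_ac_single:
  "base_change to_ac (Poly_Mapping.single m c) = Poly_Mapping.single m (to_ac c)"
  by (rule poly_mapping_eqI) (simp add: lookup_base_change_to_ac lookup_single when_def)

lemma base_change_to_ac_mult:
  "base_change to_ac (F * G) = base_change to_ac F * base_change to_ac G"
  by (rule additive_mult_hom)
    (simp_all add: base_change_to_ac_add base_change_to_ac_single mult_single)

lemma base_change_to_ac_Const: "base_change to_ac (Const c) = Const (to_ac c)"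
  by (simp add: Const_def base_change_to_ac_single)

lemma base_change_to_ac_Var: "base_change to_ac (Var j) = Var j"
  by (simp add: Var_def base_change_to_ac_single)

lemma base_change_to_ac_power: "base_change to_ac (F ^ k) = base_change to_ac F ^ k"
  by (rule multiplicative_power)
    (simp_all add: base_change_to_ac_mult base_change_to_ac_Const flip: Const_1)

lemma base_change_to_ac_symmetric_cubic:
  "base_change to_ac (symmetric_cubic n (a0, a1, a2)) =
    symmetric_cubic n (to_ac a0, to_ac a1, to_ac a2)"
  by (simp add: symmetric_cubic_def power_sum_def base_change_to_ac_add base_change_to_ac_mult
      base_change_to_ac_Const base_change_to_ac_Var base_change_to_ac_power
      additive_sum[of "base_change to_ac", OF base_change_to_ac_add])

section \<open>Lower bounds\<close>

text \<open>Gaussian elimination: each equation removes at most one unknown, so the surplus of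
  unknowns persists down to the empty system.\<close>

lemma exists_nontrivial_kernel_vector:
  fixes c :: "'i \<Rightarrow> 'j \<Rightarrow> 'a::field"
  assumes "finite I" "finite J" "card I < card J"
  shows "\<exists>u. (\<exists>j\<in>J. u j \<noteq> 0) \<and> (\<forall>i\<in>I. (\<Sum>j\<in>J. c i j * u j) = 0)"
  using assms
proof (induction I arbitrary: J c rule: finite_induct)
  case empty
  then obtain j where "j \<in> J" by fastforce
  then show ?case by (intro exI[of _ "\<lambda>_. 1"]) auto
next
  case (insert i0 I)
  show ?case
  proof (cases "\<forall>j\<in>J. c i0 j = 0")
    case True
    have "card I < card J" using insert by simp
    from insert.IH[OF insert.prems(1) this, of c]
    obtain u where "\<exists>j\<in>J. u j \<noteq> 0" "\<forall>i\<in>I. (\<Sum>j\<in>J. c i j * u j) = 0" by blast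
    moreover have "(\<Sum>j\<in>J. c i0 j * u j) = 0" using True by simp
    ultimately show ?thesis by blast
  next
    case False
    then obtain k where k: "k \<in> J" "c i0 k \<noteq> 0" by blast
    let ?J = "J - {k}"
    have "card I < card ?J" using insert k by simp
    \<comment> \<open>The reduced system arises by solving equation \<open>i0\<close> for the
      unknown \<open>k\<close> and substituting; \<open>v\<close> below restores that
      unknown.\<close>
    with insert.IH[of ?J "\<lambda>i j. c i j - c i k * c i0 j / c i0 k"] insert.prems(1)
    obtain u where u: "\<exists>j\<in>?J. u j \<noteq> 0"
      "\<And>i. i \<in> I \<Longrightarrow> (\<Sum>j\<in>?J. (c i j - c i k * c i0 j / c i0 k) * u j) = 0"
      by auto
    define t where "t = (\<Sum>j\<in>?J. c i0 j * u j)"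
    define v where "v = u(k := - t / c i0 k)"
    have split: "(\<Sum>j\<in>J. c i j * v j) = - c i k * t / c i0 k + (\<Sum>j\<in>?J. c i j * u j)" for i
      using k(1) insert.prems(1) by (simp add: sum.remove[of J k] v_def)
    have "(\<Sum>j\<in>J. c i j * v j) = 0" if "i \<in> I" for i
    proof -
      have "(\<Sum>j\<in>?J. c i j * u j) - c i k / c i0 k * t = 0"
        using u(2)[OF that] unfolding t_def
        by (simp add: sum_distrib_left sum_subtractf algebra_simps)
      then show ?thesis by (simp add: split)
    qed
    moreover have "(\<Sum>j\<in>J. c i0 j * v j) = 0"
      using k(2) by (simp add: split t_def)
    moreover have "\<exists>j\<in>J. v j \<noteq> 0" using u(1) by (auto simp: v_def)
    ultimately show ?thesis by blast
  qed
qed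

text \<open>\<open>c i j\<close> is the coefficient of the j-th variable in the i-th linear form.
  Equality of values at all points is what polarization needs.\<close>

locale cubic_decomposition =
  fixes n r :: nat and a0 a1 a2 :: "'a::field_char_0" and c :: "nat \<Rightarrow> nat \<Rightarrow> 'a"
  assumes n_ge_3: "n \<ge> 3"
    and cubes: "\<And>u. a0 * (\<Sum>j=1..n. u j) ^ 3
      + a1 * of_nat n * (\<Sum>j=1..n. u j) * (\<Sum>j=1..n. u j ^ 2)
      + a2 * of_nat n ^ 2 * (\<Sum>j=1..n. u j ^ 3)
      = (\<Sum>i=1..r. (\<Sum>j=1..n. c i j * u j) ^ 3)"
begin

definition S :: "(nat \<Rightarrow> 'a) \<Rightarrow> 'a" where "S u = (\<Sum>j=1..n. u j)"
definition B :: "(nat \<Rightarrow> 'a) \<Rightarrow> (nat \<Rightarrow> 'a) \<Rightarrow> 'a" where "B u v = (\<Sum>j=1..n. u j * v j)"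
definition M :: "(nat \<Rightarrow> 'a) \<Rightarrow> (nat \<Rightarrow> 'a) \<Rightarrow> (nat \<Rightarrow> 'a) \<Rightarrow> 'a" where
  "M u v w = (\<Sum>j=1..n. u j * v j * w j)"
definition L :: "nat \<Rightarrow> (nat \<Rightarrow> 'a) \<Rightarrow> 'a" where "L i u = (\<Sum>j=1..n. c i j * u j)"

text \<open>The symmetric trilinear form with F on the diagonal; the 1/3 averages over the three
  ways of distributing the arguments between p_1 and p_2.\<close>

definition polar :: "(nat \<Rightarrow> 'a) \<Rightarrow> (nat \<Rightarrow> 'a) \<Rightarrow> (nat \<Rightarrow> 'a) \<Rightarrow> 'a" where
  "polar u v w = a0 * (S u * S v * S w)
    + a1 * of_nat n / 3 * (S u * B v w + S v * B u w + S w * B u v)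
    + a2 * of_nat n ^ 2 * M u v w"

lemma n_nonzero: "of_nat n \<noteq> (0::'a)"
  using n_ge_3 by simp

lemma S_add: "S (\<lambda>j. u j + t * v j) = S u + t * S v"
  by (simp add: S_def sum.distrib sum_distrib_left)

lemma L_add: "L i (\<lambda>j. u j + t * v j) = L i u + t * L i v"
  by (simp add: L_def sum.distrib sum_distrib_left algebra_simps)

lemma polar_eq_sum: "polar u v w = (\<Sum>i=1..r. L i u * L i v * L i w)"
proof -
  \<comment> \<open>Inclusion-exclusion over the nonempty subsets of {u, v, w}: on a cubic form it
    gives six times the polarization, and 6 is invertible in characteristic 0.\<close>
  define D where "D Q = Q (\<lambda>j. u j + v j + w j) - Q (\<lambda>j. u j + v j) - Q (\<lambda>j. u j + w j)
     - Q (\<lambda>j. v j + w j) + Q u + Q v + (Q w :: 'a)" for Q :: "(nat \<Rightarrow> 'a) \<Rightarrow> 'a"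
  have cube: "(x + y + z) ^ 3 - (x + y) ^ 3 - (x + z) ^ 3 - (y + z) ^ 3 + x ^ 3 + y ^ 3 + z ^ 3
    = 6 * (x * y * z)" for x y z :: 'a
    by (simp add: power3_eq_cube algebra_simps)
  have S2: "S (\<lambda>j. x j + y j) = S x + S y" for x y by (simp add: S_def sum.distrib)
  have L2: "L i (\<lambda>j. x j + y j) = L i x + L i y" for i x y
    by (simp add: L_def sum.distrib algebra_simps)
  have B2: "B (\<lambda>j. x j + y j) z = B x z + B y z" "B z (\<lambda>j. x j + y j) = B z x + B z y"
    for x y z by (simp_all add: B_def sum.distrib algebra_simps)
  have Bc: "B v u = B u v" "B w u = B u w" "B w v = B v w"
    by (simp_all add: B_def mult.commute)
  have DS: "D (\<lambda>u. S u ^ 3) = 6 * (S u * S v * S w)"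
    by (simp add: D_def S2 cube)
  have DB: "D (\<lambda>u. S u * B u u) = 2 * (S u * B v w + S v * B u w + S w * B u v)"
    unfolding D_def S2 B2 Bc by (simp add: algebra_simps)
  have DM: "D (\<lambda>u. \<Sum>j=1..n. u j ^ 3) = 6 * M u v w"
    by (simp only: D_def M_def cube sum_distrib_left flip: sum.distrib sum_subtractf)
  have "6 * polar u v w = a0 * D (\<lambda>u. S u ^ 3) + a1 * of_nat n * D (\<lambda>u. S u * B u u)
    + a2 * of_nat n ^ 2 * D (\<lambda>u. \<Sum>j=1..n. u j ^ 3)"
    unfolding DS DB DM polar_def by (simp add: field_simps)
  also have "\<dots> = D (\<lambda>u. a0 * S u ^ 3 + a1 * of_nat n * (S u * B u u)
    + a2 * of_nat n ^ 2 * (\<Sum>j=1..n. u j ^ 3))"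
    unfolding D_def by (simp add: algebra_simps)
  also have "\<dots> = D (\<lambda>u. \<Sum>i=1..r. L i u ^ 3)"
    using cubes by (simp add: S_def B_def L_def power2_eq_square mult.assoc)
  also have "\<dots> = (\<Sum>i=1..r. D (\<lambda>u. L i u ^ 3))"
    by (simp add: D_def sum.distrib sum_subtractf)
  also have "\<dots> = 6 * (\<Sum>i=1..r. L i u * L i v * L i w)"
    by (simp add: D_def L2 cube sum_distrib_left)
  finally show ?thesis by simp
qed

definition unit_vec :: "nat \<Rightarrow> nat \<Rightarrow> 'a" where
  "unit_vec k = (\<lambda>j. if j = k then 1 else 0)"

lemma unit_vec_simps:
  assumes "k \<in> {1..n}"
  shows "S (unit_vec k) = 1" "B u (unit_vec k) = u k"
  using assms by (simp_all add: S_def B_def unit_vec_def if_distrib cong: if_cong)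

lemma exists_common_zero:
  assumes "finite I" "card I < n"
  shows "\<exists>u. (\<exists>j\<in>{1..n}. u j \<noteq> 0) \<and> (\<forall>i\<in>I. L i u = 0)"
  using exists_nontrivial_kernel_vector[of I "{1..n}" c] assms by (simp add: L_def)

lemma exists_common_zero_in_hyperplane:
  assumes "finite I" "card I < n - 1"
  shows "\<exists>u. (\<exists>j\<in>{1..n}. u j \<noteq> 0) \<and> S u = 0 \<and> (\<forall>i\<in>I. L i u = 0)"
proof -
  \<comment> \<open>\<open>None\<close> indexes the equation \<open>S u = 0\<close> and
    \<open>Some i\<close> the equation \<open>L i u = 0\<close>.\<close>
  have "card (insert None (Some ` I)) = Suc (card I)"
    using assms by (simp add: card_image)
  then show ?thesis
    using exists_nontrivial_kernel_vector[of "insert None (Some ` I)" "{1..n}"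
        "\<lambda>i j. case i of None \<Rightarrow> 1 | Some i \<Rightarrow> c i j"] assms
    by (simp add: L_def S_def)
qed

lemma line_2_lower_bound:
  assumes a2: "a2 = 0" and a1: "a1 \<noteq> 0"
  shows "r \<ge> 2 * (n - 1)"
proof -
  \<comment> \<open>If all these products vanish, then so does \<open>polar w u\<close>. Testing it
    on unit vectors makes all coordinates of \<open>u\<close> equal, and \<open>S u = 0\<close> then
    makes them zero.\<close>
  have nondeg: "\<exists>i\<in>{1..r}. L i w * L i u \<noteq> 0"
    if "S w = 1" "S u = 0" "\<exists>j\<in>{1..n}. u j \<noteq> 0" for u w
  proof (rule ccontr)
    assume "\<not> ?thesis"
    then have "polar w u v = 0" for v by (auto simp: polar_eq_sum intro!: sum.neutral)
    moreover have "polar w u (unit_vec k) = a1 * of_nat n / 3 * (u k + B w u)" if "k \<in> {1..n}" for k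
      unfolding polar_def using \<open>S w = 1\<close> \<open>S u = 0\<close> that by (simp add: unit_vec_simps a2)
    ultimately have "u k = - B w u" if "k \<in> {1..n}" for k
      using a1 n_nonzero that by (simp add: eq_neg_iff_add_eq_0)
    moreover from this have "S u = of_nat n * - B w u" by (simp add: S_def)
    ultimately show False using \<open>S u = 0\<close> n_nonzero that(3) by auto
  qed
  define Z where "Z w = {i\<in>{1..r}. L i w = 0}" for w
  have card_Z: "card (Z w) \<le> r" for w
    using card_mono[of "{1..r}" "Z w"] unfolding Z_def by fastforce
  have "S (unit_vec 1) = 1" using n_ge_3 by (intro unit_vec_simps) simp
  \<comment> \<open>A point of \<open>S = 1\<close> on which as many of the forms as possible
    vanish.\<close>
  then obtain w where w: "S w = 1" and max: "\<And>w'. S w' = 1 \<Longrightarrow> card (Z w') \<le> card (Z w)"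
    using ex_has_greatest_nat[of "\<lambda>w. S w = 1" "unit_vec 1" "\<lambda>w. card (Z w)" "Suc r"] card_Z
    by (auto simp: less_Suc_eq_le)
  have fin: "finite (Z w')" for w' by (simp add: Z_def)
  have "card (Z w) \<ge> n - 1"
  proof (rule ccontr)
    assume "\<not> ?thesis"
    then obtain u where u: "\<exists>j\<in>{1..n}. u j \<noteq> 0" "S u = 0" "\<And>i. i \<in> Z w \<Longrightarrow> L i u = 0"
      using exists_common_zero_in_hyperplane[OF fin] by (meson not_le)
    obtain i where i: "i \<in> {1..r}" "L i w * L i u \<noteq> 0" using nondeg[OF w u(2,1)] by blast
    \<comment> \<open>Moving along \<open>u\<close> stays in \<open>S = 1\<close>, keeps the zeros
      in \<open>Z w\<close> and is stopped where \<open>L i\<close> vanishes too, against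
      maximality.\<close>
    define w' where "w' = (\<lambda>j. w j + (- L i w / L i u) * u j)"
    have "S w' = 1" unfolding w'_def S_add using w u(2) by simp
    moreover have "L k w' = L k w + (- L i w / L i u) * L k u" for k
      unfolding w'_def by (rule L_add)
    then have "insert i (Z w) \<subseteq> Z w'" using i u(3) by (auto simp: Z_def)
    then have "card (insert i (Z w)) \<le> card (Z w')" using fin by (intro card_mono)
    moreover have "i \<notin> Z w" using i by (auto simp: Z_def)
    ultimately show False using max[of w'] fin[of w] by simp
  qed
  \<comment> \<open>A \<open>u\<close> killed by all forms that are nonzero at \<open>w\<close>
    would make every product in \<open>nondeg\<close> vanish.\<close>
  moreover have "card ({1..r} - Z w) \<ge> n - 1"
  proof (rule ccontr)
    assume "\<not> ?thesis"
    then obtain u where u: "\<exists>j\<in>{1..n}. u j \<noteq> 0" "S u = 0" "\<And>i. i \<in> {1..r} - Z w \<Longrightarrow> L i u = 0"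
      using exists_common_zero_in_hyperplane[of "{1..r} - Z w"] by (meson not_le finite_Diff finite_atLeastAtMost)
    then show False using nondeg[OF w u(2,1)] by (auto simp: Z_def)
  qed
  moreover have "card ({1..r} - Z w) = r - card (Z w)"
    by (subst card_Diff_subset) (auto simp: Z_def)
  ultimately show ?thesis using card_Z[of w] by linarith
qed

end

section \<open>Lower bounds for points off the line a2 = 0\<close>

locale cubic_decomposition_off_line_2 = cubic_decomposition +
  assumes a2: "a2 \<noteq> 0"
begin

text \<open>\<open>b\<close> is the parameter \<beta>/\<alpha> of the point of the curve with the
  same ratio a1 : a2, and \<open>e\<close> is the displacement from it in the direction of p_1^3.
  Thus \<open>e = 0\<close> describes the curve and \<open>b = -1\<close> the line a1 + 3 a2 =
  0.\<close>

definition b :: 'a where "b = a1 / (3 * a2)"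
definition e :: 'a where "e = a0 - a2 * (3 * b ^ 2 + b ^ 3)"
definition y :: "(nat \<Rightarrow> 'a) \<Rightarrow> nat \<Rightarrow> 'a" where "y u j = of_nat n * u j + b * S u"

text \<open>The factor \<open>1 + b\<close> is what singles out \<open>b = -1\<close>: there the
  coordinates \<open>y\<close> sum to zero and are linearly dependent.\<close>

lemma sum_y: "(\<Sum>j=1..n. y u j) = of_nat n * (1 + b) * S u"
  by (simp add: y_def sum.distrib algebra_simps flip: sum_distrib_left)
    (simp add: S_def)

lemma y_add: "y (\<lambda>j. u j + t * v j) k = y u k + t * y v k"
  by (simp add: y_def S_add algebra_simps)

lemma polar_eq_y:
  "polar u v w = a2 / of_nat n * (\<Sum>j=1..n. y u j * y v j * y w j) + e * (S u * S v * S w)"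
proof -
  let ?N = "of_nat n :: 'a"
  have "(\<Sum>j=1..n. y u j * y v j * y w j) = (\<Sum>j=1..n. ?N ^ 3 * (u j * v j * w j)
    + ?N ^ 2 * b * (S u * (v j * w j) + S v * (u j * w j) + S w * (u j * v j))
    + ?N * b ^ 2 * (S u * S v * w j + S u * S w * v j + S v * S w * u j)
    + b ^ 3 * (S u * S v * S w))"
    by (rule sum.cong) (simp_all add: y_def power2_eq_square power3_eq_cube algebra_simps)
  also have "\<dots> = ?N ^ 3 * M u v w + ?N ^ 2 * b * (S u * B v w + S v * B u w + S w * B u v)
    + ?N * b ^ 2 * (S u * S v * S w + S u * S w * S v + S v * S w * S u)
    + ?N * (b ^ 3 * (S u * S v * S w))"
    by (simp add: sum.distrib M_def B_def flip: sum_distrib_left) (simp add: S_def)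
  finally have *: "(\<Sum>j=1..n. y u j * y v j * y w j) = ?N * (?N ^ 2 * M u v w
    + ?N * b * (S u * B v w + S v * B u w + S w * B u v) + (3 * b ^ 2 + b ^ 3) * (S u * S v * S w))"
    by (simp add: power2_eq_square power3_eq_cube algebra_simps)
  have a1: "a2 * b = a1 / 3" using a2 by (simp add: b_def)
  have "a2 / ?N * (\<Sum>j=1..n. y u j * y v j * y w j) + e * (S u * S v * S w) =
    a0 * (S u * S v * S w) + ?N * (a2 * b) * (S u * B v w + S v * B u w + S w * B u v)
    + a2 * ?N ^ 2 * M u v w"
    unfolding * e_def using n_nonzero by (simp add: algebra_simps)
  then show ?thesis unfolding polar_def a1 by (simp add: mult.commute)
qed

text \<open>On the k-th unit vector the condition involves \<open>k\<close> only through
  \<open>y f k * y g k\<close>, so this product is a constant \<open>\<kappa>\<close>; inserting it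
  into the sum \<open>\<Sigma>\<close> gives the second relation.\<close>

lemma polar_zero_imp:
  assumes "\<And>w. polar f g w = 0"
  obtains \<kappa> where "\<And>k. k \<in> {1..n} \<Longrightarrow> y f k * y g k = \<kappa>" "a2 * (1 + b) * \<kappa> = - e * (S f * S g)"
proof -
  let ?N = "of_nat n :: 'a"
  define \<Sigma> where "\<Sigma> = (\<Sum>j=1..n. y f j * y g j)"
  have eq: "a2 * (y f k * y g k) + a2 * b / ?N * \<Sigma> + e * (S f * S g) = 0" if "k \<in> {1..n}" for k
  proof -
    have yk: "y (unit_vec k) j = (if j = k then ?N else 0) + b" for j
      by (simp add: y_def unit_vec_simps[OF that]) (simp add: unit_vec_def)
    have "(\<Sum>j=1..n. y f j * y g j * y (unit_vec k) j) =
      (\<Sum>j=1..n. (if j = k then ?N * (y f j * y g j) else 0) + b * (y f j * y g j))"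
      by (rule sum.cong) (simp_all add: yk algebra_simps)
    also have "\<dots> = ?N * (y f k * y g k) + b * \<Sigma>"
      using that by (simp add: sum.distrib \<Sigma>_def sum_distrib_left)
    finally show ?thesis
      using assms[of "unit_vec k"] n_nonzero
      by (simp add: polar_eq_y unit_vec_simps[OF that] field_simps)
  qed
  define \<kappa> where "\<kappa> = - (a2 * b / ?N * \<Sigma> + e * (S f * S g)) / a2"
  have \<kappa>: "y f k * y g k = \<kappa>" if "k \<in> {1..n}" for k
  proof -
    have "a2 * (y f k * y g k) = - (a2 * b / ?N * \<Sigma> + e * (S f * S g))"
      using eq[OF that] by (simp only: eq_neg_iff_add_eq_0 add.assoc)
    then show ?thesis using a2 unfolding \<kappa>_def by (metis nonzero_mult_div_cancel_left)
  qed
  have "\<Sigma> = ?N * \<kappa>" by (simp add: \<Sigma>_def \<kappa>)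
  then have "a2 * (1 + b) * \<kappa> = - e * (S f * S g)"
    using eq[of 1] \<kappa>[of 1] n_nonzero n_ge_3 by (simp add: algebra_simps add_eq_0_iff2)
  with \<kappa> that show thesis by blast
qed

lemma y_zero_imp:
  assumes "\<And>k. k \<in> {1..n} \<Longrightarrow> y f k = 0" "j \<in> {1..n}"
  shows "f j = - b * S f / of_nat n"
  using assms(1)[OF assms(2)] n_nonzero by (simp add: y_def field_simps add_eq_0_iff2)

lemma y_zero_imp_S_zero:
  assumes "\<And>k. k \<in> {1..n} \<Longrightarrow> y f k = 0" "b \<noteq> -1"
  shows "S f = 0"
proof -
  have "1 + b \<noteq> 0" using assms(2) by (metis add_eq_0_iff)
  then show ?thesis using sum_y[of f] assms(1) n_nonzero by simp
qed

text \<open>A common zero of all the forms lies in the radical of \<open>polar\<close>. Pairing it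
  with differences of unit vectors kills its coordinates \<open>y\<close>, and then
  \<open>S f = 0\<close> makes it zero.\<close>

lemma nondegenerate:
  assumes "e \<noteq> 0 \<or> b \<noteq> -1" "\<And>i. i \<in> {1..r} \<Longrightarrow> L i f = 0" "j \<in> {1..n}"
  shows "f j = 0"
proof -
  have polar0: "polar f g w = 0" for g w by (simp add: polar_eq_sum assms(2))
  have y0: "y f k = 0" if "k \<in> {1..n}" for k
  proof -
    \<comment> \<open>The third index \<open>m\<close> lies outside the support of \<open>g\<close>,
      so the constant product is 0 there; at \<open>k\<close> it is
      \<open>n * y f k\<close>.\<close>
    obtain l m where lm: "l \<in> {1..n}" "m \<in> {1..n}" "l \<noteq> k" "m \<noteq> k" "l \<noteq> m"
    proof (cases "k = 1")
      case True
      then show thesis using n_ge_3 by (intro that[of 2 3]) auto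
    next
      case False
      then show thesis using n_ge_3 by (cases "k = 2") (auto intro: that[of 1 2] that[of 1 3])
    qed
    define g where "g j = unit_vec k j + (-1) * unit_vec l j" for j
    have Sg: "S g = 0" unfolding g_def[abs_def] S_add using that lm by (simp add: unit_vec_simps)
    obtain \<kappa> where "\<And>k. k \<in> {1..n} \<Longrightarrow> y f k * y g k = \<kappa>"
      using polar_zero_imp[OF polar0] by blast
    from this[of k] this[of m] lm that n_nonzero show ?thesis
      by (simp add: y_def[of g] Sg) (auto simp: g_def unit_vec_def)
  qed
  have "S f = 0"
  proof (cases "b = -1")
    case True
    \<comment> \<open>For \<open>b = -1\<close> the left side vanishes, and \<open>e\<close> is
      nonzero, so \<open>S f = 0\<close>.\<close>
    obtain \<kappa> where "a2 * (1 + b) * \<kappa> = - e * (S f * S (unit_vec 1))"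
      using polar_zero_imp[OF polar0] by blast
    then show ?thesis using True assms(1) n_ge_3 by (simp add: unit_vec_simps)
  next
    case False
    then show ?thesis using y_zero_imp_S_zero[OF y0] by simp
  qed
  then show ?thesis using y_zero_imp[OF y0 assms(3)] by simp
qed

lemma rank_ge:
  assumes "e \<noteq> 0 \<or> b \<noteq> -1"
  shows "r \<ge> n"
proof (rule ccontr)
  assume "\<not> ?thesis"
  then obtain u where "\<exists>j\<in>{1..n}. u j \<noteq> 0" "\<forall>i\<in>{1..r}. L i u = 0"
    using exists_common_zero[of "{1..r}"] by auto
  then show False using nondegenerate[OF assms, of u] by blast
qed

text \<open>
  If \<open>r = n\<close>, the basis \<open>f\<close> dual to the \<open>L\<^sub>i\<close> consists of vectors whose pairwise products
  (in the coordinates \<open>y\<close>) are constant. A nonzero constant would make all remaining vectors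
  proportional, so the supports are disjoint; but at least \<open>n - 1\<close> of them have two or more
  elements, because the coordinates sum to zero.
\<close>
lemma rank_ne:
  assumes e: "e \<noteq> 0" and bn: "b \<noteq> -1 \<or> n \<ge> 4"
  shows "r \<noteq> n"
proof
  assume r: "r = n"
  \<comment> \<open>The dual basis up to scaling: a nonzero common zero of the other n - 1 forms
    exists, and nondegeneracy keeps \<open>L i\<close> nonzero on it.\<close>
  have "\<exists>f. L i f \<noteq> 0 \<and> (\<forall>k\<in>{1..n} - {i}. L k f = 0)" if i: "i \<in> {1..n}" for i
  proof -
    have "card ({1..n} - {i}) < n" using i n_ge_3 by simp
    then obtain f where f: "\<exists>j\<in>{1..n}. f j \<noteq> 0" "\<forall>k\<in>{1..n} - {i}. L k f = 0"
      using exists_common_zero[of "{1..n} - {i}"] by auto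
    then have "L i f \<noteq> 0" using nondegenerate[of f] e r by (metis DiffI singletonD)
    with f show ?thesis by blast
  qed
  then obtain f where f: "\<And>i. i \<in> {1..n} \<Longrightarrow> L i (f i) \<noteq> 0"
    "\<And>i k. i \<in> {1..n} \<Longrightarrow> k \<in> {1..n} \<Longrightarrow> k \<noteq> i \<Longrightarrow> L k (f i) = 0"
    by (metis DiffI singletonD)
  have "\<exists>\<kappa>. (\<forall>k\<in>{1..n}. y (f i) k * y (f j) k = \<kappa>) \<and> a2 * (1 + b) * \<kappa> = - e * (S (f i) * S (f j))"
    if "i \<in> {1..n}" "j \<in> {1..n}" "i \<noteq> j" for i j
  proof -
    have "L k (f i) * L k (f j) = 0" if "k \<in> {1..n}" for k
      using f(2)[of i k] f(2)[of j k] that \<open>i \<in> {1..n}\<close> \<open>j \<in> {1..n}\<close> \<open>i \<noteq> j\<close> by (cases "k = i") auto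
    then have "polar (f i) (f j) w = 0" for w
      unfolding polar_eq_sum r by (intro sum.neutral) simp
    then show ?thesis using polar_zero_imp[of "f i" "f j"] by metis
  qed
  then obtain \<kappa> where \<kappa>:
    "\<And>i j k. \<lbrakk>i \<in> {1..n}; j \<in> {1..n}; i \<noteq> j; k \<in> {1..n}\<rbrakk> \<Longrightarrow> y (f i) k * y (f j) k = \<kappa> i j"
    "\<And>i j. \<lbrakk>i \<in> {1..n}; j \<in> {1..n}; i \<noteq> j\<rbrakk> \<Longrightarrow> a2 * (1 + b) * \<kappa> i j = - e * (S (f i) * S (f j))"
    by metis
  have L_const: "L i g = t * L i (\<lambda>_. 1)" if "\<And>j. j \<in> {1..n} \<Longrightarrow> g j = t" for i g t
    using that by (simp add: L_def sum_distrib_left mult.commute)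
  \<comment> \<open>The kernel of \<open>y\<close> is trivial for \<open>b \<noteq> -1\<close> and
    consists of constant vectors for \<open>b = -1\<close>; these two facts give its effect on the
    forms.\<close>
  have L_zero: "L i g = 0" if "\<And>k. k \<in> {1..n} \<Longrightarrow> y g k = 0" "b \<noteq> -1" for i g
    using y_zero_imp[OF that(1)] y_zero_imp_S_zero[OF that(1,2)] by (simp add: L_def)
  have L_ker: "L i g = S g / of_nat n * L i (\<lambda>_. 1)"
    if "\<And>k. k \<in> {1..n} \<Longrightarrow> y g k = 0" "b = -1" for i g
  proof (rule L_const)
    show "g j = S g / of_nat n" if "j \<in> {1..n}" for j
      using y_zero_imp[of g j] that \<open>\<And>k. k \<in> {1..n} \<Longrightarrow> y g k = 0\<close> \<open>b = -1\<close> by simp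
  qed
  have \<kappa>0: "\<kappa> i j = 0" if ij: "i \<in> {1..n}" "j \<in> {1..n}" "i \<noteq> j" for i j
  proof (rule ccontr)
    assume nz: "\<kappa> i j \<noteq> 0"
    \<comment> \<open>The multiple of \<open>f j\<close> is chosen so that
      \<open>y (f i) l * y (g k) l = 0\<close> for all \<open>l\<close>. As \<open>y (f i)\<close>
      has no zero coordinate, \<open>g k\<close> lies in the kernel of \<open>y\<close>.\<close>
    define g where "g k = (\<lambda>l. f k l + (- \<kappa> i k / \<kappa> i j) * f j l)" for k
    have yg: "y (g k) l = 0" if "k \<in> {1..n} - {i, j}" "l \<in> {1..n}" for k l
    proof -
      have "y (f i) l * (y (f k) l - \<kappa> i k / \<kappa> i j * y (f j) l) = 0"
        using \<kappa>(1)[of i k l] \<kappa>(1)[of i j l] that ij nz by (simp add: algebra_simps)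
      moreover have "y (f i) l \<noteq> 0" using \<kappa>(1)[of i j l] that ij nz by auto
      ultimately show ?thesis unfolding g_def y_add by simp
    qed
    have L_g: "L l (g k) = L l (f k) + (- \<kappa> i k / \<kappa> i j) * L l (f j)" for k l
      unfolding g_def by (rule L_add)
    have Lg: "L k (g k) \<noteq> 0" "\<And>k'. k' \<in> {1..n} - {i, j, k} \<Longrightarrow> L k' (g k) = 0"
      if "k \<in> {1..n} - {i, j}" for k
      using f(1)[of k] f(2)[of j k] f(2)[of j] f(2)[of k] that ij by (auto simp: L_g)
    have "card ({1..n} - {i, j}) > 0" using ij n_ge_3 by (simp add: card_Diff_subset)
    then obtain k where k: "k \<in> {1..n} - {i, j}" by (metis card_gt_0_iff equals0I)
    have b: "b = -1" using L_zero[OF yg[OF k]] Lg(1)[OF k] by blast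
    \<comment> \<open>Here \<open>n \<ge> 4\<close> is needed. The vectors \<open>g k\<close> and
      \<open>g k'\<close> are both constant, yet \<open>L k'\<close> vanishes on the first and not
      on the second, while the first is nonzero.\<close>
    then have "card ({1..n} - {i, j, k}) > 0"
      using bn ij k by (simp add: card_Diff_subset)
    then obtain k' where k': "k' \<in> {1..n} - {i, j, k}" by (metis card_gt_0_iff equals0I)
    then have "k' \<in> {1..n} - {i, j}" by blast
    then show False
      using L_ker[OF yg[OF k] b] L_ker[OF yg[OF \<open>k' \<in> {1..n} - {i, j}\<close>] b]
        Lg(1)[OF k] Lg(1)[of k'] Lg(2)[OF k k'] by (metis mult_eq_0_iff)
  qed
  define D where "D i = {k\<in>{1..n}. y (f i) k \<noteq> 0}" for i
  \<comment> \<open>A nonempty support with zero coordinate sum has at least two elements; such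
    indices are collected in \<open>G\<close>.\<close>
  define G where "G = {i\<in>{1..n}. D i \<noteq> {} \<and> (\<Sum>k=1..n. y (f i) k) = 0}"
  have disj: "D i \<inter> D j = {}" if "i \<in> {1..n}" "j \<in> {1..n}" "i \<noteq> j" for i j
    using \<kappa>(1)[OF that] \<kappa>0[OF that] by (auto simp: D_def)
  \<comment> \<open>For \<open>b = -1\<close> every sum is zero, so two indices outside
    \<open>G\<close> would give two constant vectors in the dual basis. Otherwise both have
    \<open>S \<noteq> 0\<close>, against \<open>\<kappa> i j = 0\<close> and
    \<open>e \<noteq> 0\<close>.\<close>
  have bad: "i = j" if "i \<in> {1..n} - G" "j \<in> {1..n} - G" for i j
  proof (rule ccontr)
    assume "i \<noteq> j"
    then have ij: "i \<in> {1..n}" "j \<in> {1..n}" "i \<noteq> j" using that by auto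
    show False
    proof (cases "b = -1")
      case True
      then have "D i = {}" "D j = {}" using that unfolding G_def sum_y by auto
      then have "y (f i) k = 0" "y (f j) k = 0" if "k \<in> {1..n}" for k
        using that by (auto simp: D_def)
      then show False
        using L_ker[of "f i"] L_ker[of "f j"] True f(1)[OF ij(1)] f(1)[OF ij(2)] f(2)[OF ij(2,1,3)]
        by (metis mult_eq_0_iff)
    next
      case False
      have "S (f l) \<noteq> 0" if "l \<in> {1..n} - G" for l
      proof -
        have "D l \<noteq> {}" using L_zero[of "f l"] False f(1)[of l] that by (auto simp: D_def)
        then show ?thesis using that unfolding G_def sum_y by auto
      qed
      then show False using \<kappa>(2)[OF ij] \<kappa>0[OF ij] that e by auto
    qed
  qed
  have fin: "finite G" by (simp add: G_def)
  have "card ({1..n} - G) \<le> 1"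
    using bad by (simp add: card_le_Suc0_iff_eq)
  moreover have "card ({1..n} - G) = n - card G"
    by (subst card_Diff_subset) (auto simp: G_def)
  ultimately have "card G \<ge> n - 1" by linarith
  moreover have "card (D i) \<ge> 2" if "i \<in> G" for i
  proof -
    obtain k where k: "k \<in> {1..n}" "y (f i) k \<noteq> 0" using \<open>i \<in> G\<close> by (auto simp: G_def D_def)
    have "\<exists>l\<in>{1..n} - {k}. y (f i) l \<noteq> 0"
    proof (rule ccontr)
      assume "\<not> ?thesis"
      then have "(\<Sum>l\<in>{1..n} - {k}. y (f i) l) = 0" by (intro sum.neutral) auto
      then show False using k \<open>i \<in> G\<close> by (simp add: G_def sum.remove[of _ k])
    qed
    then obtain l where "l \<in> {1..n}" "l \<noteq> k" "y (f i) l \<noteq> 0" by blast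
    then have "{k, l} \<subseteq> D i" "card {k, l} = 2" using k by (auto simp: D_def)
    then show ?thesis using card_mono[of "D i" "{k, l}"] by (simp add: D_def)
  qed
  \<comment> \<open>Disjoint supports inside {1..n} give 2(n - 1) \<le> n, which fails for n \<ge>
    3.\<close>
  then have "2 * card G \<le> (\<Sum>i\<in>G. card (D i))"
    using sum_mono[of G "\<lambda>_. 2" "\<lambda>i. card (D i)"] by simp
  moreover have "(\<Sum>i\<in>G. card (D i)) = card (\<Union>i\<in>G. D i)"
    by (rule card_UN_disjoint[symmetric, OF fin]) (use disj in \<open>auto simp: D_def G_def\<close>)
  moreover have "card (\<Union>i\<in>G. D i) \<le> card {1..n}"
    by (intro card_mono) (auto simp: D_def)
  ultimately show False using n_ge_3 by simp
qed

end

section \<open>Explicit decompositions\<close>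

lemma Const_add: "Const (c + d) = Const c + Const d"
  by (simp add: Const_def single_add)

lemma Const_mult: "Const (c * d) = Const c * Const d"
  by (simp add: Const_def mult_single)

lemma Const_0: "Const 0 = 0"
  by (simp add: Const_def)

lemma Const_uminus: "Const (- c) = - Const c"
  using Const_add[of c "- c"] by (simp add: Const_0 eq_neg_iff_add_eq_0 add.commute)

lemma Const_diff: "Const (c - d) = Const c - Const d"
  using Const_add[of c "- d"] by (simp add: Const_uminus)

lemma Const_power: "Const (c ^ k) = Const c ^ k"
  by (induction k) (simp_all add: Const_1 Const_mult)

lemma Const_of_nat: "Const (of_nat k) = of_nat k"
  by (induction k) (simp_all add: Const_0 Const_1 Const_add)

lemma Const_numeral: "Const (numeral k) = numeral k"
  using Const_of_nat[of "numeral k"] by simp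

lemma Const_sum: "Const (sum f A) = (\<Sum>i\<in>A. Const (f i))"
  by (rule additive_sum) (rule Const_add)

lemma linear_form_Const_mult_Var:
  assumes "j \<in> {1..n}"
  shows "linear_form n (Const c * Var j)"
  unfolding linear_form_def
proof (intro exI)
  have "(\<Sum>i=1..n. Const (if i = j then c else 0) * Var i) =
    (\<Sum>i=1..n. if i = j then Const c * Var i else 0)"
    by (rule sum.cong) (simp_all add: Const_0)
  then show "Const c * Var j = (\<Sum>i=1..n. Const (if i = j then c else 0) * Var i)"
    using assms by simp
qed

lemma linear_form_add:
  assumes "linear_form n L" "linear_form n L'"
  shows "linear_form n (L + L')"
proof -
  obtain c c' where "L = (\<Sum>j=1..n. Const (c j) * Var j)" "L' = (\<Sum>j=1..n. Const (c' j) * Var j)"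
    using assms unfolding linear_form_def by blast
  then have "L + L' = (\<Sum>j=1..n. Const (c j + c' j) * Var j)"
    by (simp add: Const_add distrib_right sum.distrib)
  then show ?thesis unfolding linear_form_def by (intro exI[of _ "\<lambda>j. c j + c' j"])
qed

lemma linear_form_Const_mult:
  assumes "linear_form n L"
  shows "linear_form n (Const c * L)"
proof -
  obtain d where "L = (\<Sum>j=1..n. Const (d j) * Var j)"
    using assms unfolding linear_form_def by blast
  then have "Const c * L = (\<Sum>j=1..n. Const (c * d j) * Var j)"
    by (simp add: Const_mult sum_distrib_left mult.assoc)
  then show ?thesis unfolding linear_form_def by (intro exI[of _ "\<lambda>j. c * d j"])
qed

lemma linear_form_diff:
  assumes "linear_form n L" "linear_form n L'"
  shows "linear_form n (L - L')"
  using linear_form_add[OF assms(1) linear_form_Const_mult[OF assms(2), of "-1"]]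
  by (simp add: Const_uminus Const_1)

lemma linear_form_Var: "j \<in> {1..n} \<Longrightarrow> linear_form n (Var j)"
  using linear_form_Const_mult_Var[of j n 1] by (simp add: Const_1)

text \<open>Partial sums with \<open>m < n\<close> are included because the Helmert forms below use
  them.\<close>

lemma linear_form_power_sum_1:
  assumes "m \<le> n"
  shows "linear_form n (power_sum m 1 :: 'a::comm_ring_1 mpoly)"
  unfolding linear_form_def power_sum_def
proof (intro exI)
  have "(\<Sum>j=1..n. Const (if j \<le> m then 1 else 0) * Var j :: 'a mpoly) =
    (\<Sum>j=1..n. if j \<in> {1..m} then Var j ^ 1 else 0)"
    by (rule sum.cong) (simp_all add: Const_0 Const_1)
  also have "\<dots> = (\<Sum>j\<in>{1..n} \<inter> {1..m}. Var j ^ 1)" by (rule sum.inter_restrict[symmetric]) simp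
  also have "{1..n} \<inter> {1..m} = {1..m}" using assms by auto
  finally show "(\<Sum>j=1..m. Var j ^ 1 :: 'a mpoly) = (\<Sum>j=1..n. Const (if j \<le> m then 1 else 0) * Var j)" by simp
qed

section \<open>Sums of powers of linear forms and upper bounds\<close>

definition is_waring_sum :: "nat \<Rightarrow> nat \<Rightarrow> nat \<Rightarrow> 'a::field mpoly \<Rightarrow> bool" where
  "is_waring_sum n m r F \<longleftrightarrow>
    (\<exists>L. (\<forall>i\<in>{1..r}. linear_form n (L i)) \<and> F = (\<Sum>i=1..r. L i ^ m))"

lemma waring_rank_eqI:
  assumes "is_waring_sum n m r F" "\<And>s. is_waring_sum n m s F \<Longrightarrow> r \<le> s"
  shows "waring_rank n m F = r"
  unfolding waring_rank_def
  by (rule Least_equality) (use assms in \<open>auto simp: is_waring_sum_def\<close>)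

lemma is_waring_sum_0: "is_waring_sum n m 0 0"
  by (simp add: is_waring_sum_def)

lemma is_waring_sum_power: "linear_form n L \<Longrightarrow> is_waring_sum n m 1 (L ^ m)"
  unfolding is_waring_sum_def by (intro exI[of _ "\<lambda>_. L"]) simp

lemma is_waring_sum_add:
  assumes "is_waring_sum n m r F" "is_waring_sum n m s G"
  shows "is_waring_sum n m (r + s) (F + G)"
proof -
  obtain L L' where L: "\<And>i. i \<in> {1..r} \<Longrightarrow> linear_form n (L i)" "F = (\<Sum>i=1..r. L i ^ m)"
    and L': "\<And>i. i \<in> {1..s} \<Longrightarrow> linear_form n (L' i)" "G = (\<Sum>i=1..s. L' i ^ m)"
    using assms unfolding is_waring_sum_def by blast
  define K where "K i = (if i \<le> r then L i else L' (i - r))" for i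
  have "(\<Sum>i=1..r + s. K i ^ m) = (\<Sum>i=1..r. K i ^ m) + (\<Sum>i=1 + r..s + r. K i ^ m)"
    using sum.ub_add_nat[of 1 r "\<lambda>i. K i ^ m" s] by (simp add: add.commute)
  also have "(\<Sum>i=1 + r..s + r. K i ^ m) = (\<Sum>i=1..s. K (i + r) ^ m)"
    by (rule sum.shift_bounds_cl_nat_ivl)
  finally have "F + G = (\<Sum>i=1..r + s. K i ^ m)" by (simp add: L L' K_def)
  moreover have "\<forall>i\<in>{1..r + s}. linear_form n (K i)" by (auto simp: K_def intro!: L(1) L'(1))
  ultimately show ?thesis unfolding is_waring_sum_def by blast
qed

lemma is_waring_sum_sum:
  assumes "finite A" "\<And>i. i \<in> A \<Longrightarrow> is_waring_sum n m k (F i)"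
  shows "is_waring_sum n m (card A * k) (\<Sum>i\<in>A. F i)"
  using assms by (induction A rule: finite_induct) (auto intro: is_waring_sum_0 is_waring_sum_add)

text \<open>Algebraic closedness lets an m-th root of the coefficient be absorbed into the linear
  form.\<close>

lemma is_waring_sum_Const_mult_power:
  fixes c :: "'a::alg_closed_field"
  assumes "linear_form n L" "m > 0"
  shows "is_waring_sum n m 1 (Const c * L ^ m)"
proof -
  obtain g where "g ^ m = c" using nth_root_exists assms(2) by blast
  then have "Const c * L ^ m = (Const g * L) ^ m" by (auto simp: power_mult_distrib Const_power)
  then show ?thesis using is_waring_sum_power[OF linear_form_Const_mult[OF assms(1)]] by metis
qed

lemma symmetric_cubic_add_cube:
  "symmetric_cubic n (a0 + e, a1, a2) = symmetric_cubic n (a0, a1, a2) + Const e * power_sum n 1 ^ 3"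
  by (simp add: symmetric_cubic_def Const_add algebra_simps)

text \<open>Expanding the cubes and summing over \<open>j\<close> turns the powers of the variables
  into power sums.\<close>

lemma symmetric_cubic_curve_C:
  fixes a b :: "'a::field_char_0"
  assumes "n > 0"
  shows "symmetric_cubic n (a * (3 * b ^ 2 + b ^ 3), 3 * a * b, a) =
    (\<Sum>j=1..n. Const (a / of_nat n) * (of_nat n * Var j + Const b * power_sum n 1) ^ 3)"
proof -
  let ?N = "of_nat n :: 'a mpoly" and ?b = "Const b" and ?p = "power_sum n 1 :: 'a mpoly"
  define \<alpha> where "\<alpha> = Const (a / of_nat n)"
  have a: "Const a = \<alpha> * ?N"
    using assms by (simp add: \<alpha>_def flip: Const_of_nat Const_mult)
  have "(\<Sum>j=1..n. (?N * Var j + ?b * ?p) ^ 3) =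
    (\<Sum>j=1..n. ?N ^ 3 * Var j ^ 3 + 3 * ?N ^ 2 * ?b * ?p * Var j ^ 2
      + 3 * ?N * ?b ^ 2 * ?p ^ 2 * Var j ^ 1 + ?b ^ 3 * ?p ^ 3)"
    by (rule sum.cong) (simp_all add: power2_eq_square power3_eq_cube algebra_simps)
  also have "\<dots> = ?N ^ 3 * power_sum n 3 + 3 * ?N ^ 2 * ?b * ?p * power_sum n 2
      + 3 * ?N * ?b ^ 2 * ?p ^ 2 * ?p + ?N * (?b ^ 3 * ?p ^ 3)"
    unfolding sum.distrib power_sum_def by (simp add: sum_distrib_left)
  finally have *: "(\<Sum>j=1..n. (?N * Var j + ?b * ?p) ^ 3) = ?N ^ 3 * power_sum n 3
      + 3 * ?N ^ 2 * ?b * ?p * power_sum n 2 + 3 * ?N * ?b ^ 2 * ?p ^ 2 * ?p + ?N * (?b ^ 3 * ?p ^ 3)" .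
  show ?thesis
    unfolding symmetric_cubic_def sum_distrib_left[symmetric] * prod.case \<alpha>_def[symmetric]
    by (simp add: Const_mult Const_add Const_power Const_of_nat Const_numeral a
        power2_eq_square power3_eq_cube algebra_simps)
qed

lemma is_waring_sum_curve_C:
  fixes a b :: "'a::{alg_closed_field, field_char_0}"
  assumes "n > 0"
  shows "is_waring_sum n 3 n (symmetric_cubic n (a * (3 * b ^ 2 + b ^ 3), 3 * a * b, a))"
proof -
  have lin: "linear_form n (of_nat n * Var j + Const b * power_sum n 1 :: 'a mpoly)" if "j \<in> {1..n}" for j
    using that linear_form_power_sum_1[of n n]
    by (auto intro!: linear_form_add linear_form_Const_mult linear_form_Var simp flip: Const_of_nat)
  have "is_waring_sum n 3 (card {1..n} * 1)
    (\<Sum>j=1..n. Const (a / of_nat n) * (of_nat n * Var j + Const b * power_sum n 1) ^ 3)"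
    by (intro is_waring_sum_sum is_waring_sum_Const_mult_power lin) simp_all
  then show ?thesis unfolding symmetric_cubic_curve_C[OF assms] by simp
qed

text \<open>At \<open>b = -1\<close> the three forms \<open>Y j\<close> sum to zero, so the cubic is
  a multiple of Y_1 Y_2 (Y_1 + Y_2), a binary cubic with distinct factors. A primitive cube root of
  unity writes it as a combination of two cubes.\<close>

lemma is_waring_sum_pt_Q:
  fixes a :: "'a::{alg_closed_field, field_char_0}"
  shows "is_waring_sum 3 3 2 (symmetric_cubic 3 (2 * a, - 3 * a, a))"
proof -
  obtain \<omega> :: 'a where "(\<Sum>k\<le>2. 1 * \<omega> ^ k) = 0" using alg_closed[of 2 "\<lambda>_. 1 :: 'a"] by auto
  then have \<omega>: "\<omega> ^ 2 + \<omega> + 1 = 0" by (simp add: numeral_2_eq_2 algebra_simps)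
  have nz: "\<omega> - \<omega> ^ 2 \<noteq> 0"
  proof
    assume "\<omega> - \<omega> ^ 2 = 0"
    then have "\<omega> * (1 - \<omega>) = 0" by (simp add: power2_eq_square algebra_simps)
    then have "\<omega> = 0 \<or> \<omega> = 1" by simp
    with \<omega> show False by auto
  qed
  \<comment> \<open>Cancels the factor \<open>\<omega> - \<omega> ^ 2\<close> produced by the
    difference of the two cubes.\<close>
  define A where "A = 1 / (\<omega> - \<omega> ^ 2)"
  define w where "w = Const \<omega>"
  have w: "w ^ 2 + w + 1 = 0"
    using arg_cong[OF \<omega>, of Const] by (simp add: w_def Const_add Const_power Const_1 Const_0)
  have A: "Const A * (w - w ^ 2) = 1"
    using nz by (simp add: w_def A_def flip: Const_mult Const_diff Const_power Const_1)
  define Y :: "nat \<Rightarrow> 'a mpoly" where "Y j = 3 * Var j + Const (- 1) * power_sum 3 1" for j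
  have lin: "linear_form 3 (Y j)" if "j \<in> {1..3}" for j
    using that linear_form_power_sum_1[of 3 3] unfolding Y_def
    by (auto intro!: linear_form_add linear_form_Const_mult linear_form_Var simp flip: Const_numeral)
  have Y3: "Y 3 = - Y 1 - Y 2"
    by (simp add: Y_def power_sum_def Const_uminus Const_1 numeral_3_eq_3 numeral_2_eq_2)
  have "w ^ 3 - 1 = (w - 1) * (w ^ 2 + w + 1)"
    by (simp add: power2_eq_square power3_eq_cube algebra_simps)
  then have w3: "w ^ 3 = 1" by (simp add: w)
  have w4: "(w ^ 2) ^ 2 = w" using w3 by (simp add: power2_eq_square power3_eq_cube mult.assoc)
  have w6: "(w ^ 2) ^ 3 = 1" using w3 by (metis power_mult mult.commute power_one)
  have "Y 1 ^ 3 + Y 2 ^ 3 + Y 3 ^ 3 =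
    Const A * (w - w ^ 2) * (- 3 * Y 1 ^ 2 * Y 2 - 3 * Y 1 * Y 2 ^ 2)"
    unfolding A Y3 by (simp add: power2_eq_square power3_eq_cube algebra_simps)
  also have "\<dots> = Const A * ((w - w ^ 2) * (- 3 * Y 1 ^ 2 * Y 2 - 3 * Y 1 * Y 2 ^ 2))"
    by (simp add: mult.assoc)
  also have "(w - w ^ 2) * (- 3 * Y 1 ^ 2 * Y 2 - 3 * Y 1 * Y 2 ^ 2) =
     (Y 1 - w * Y 2) ^ 3 - (Y 1 - w ^ 2 * Y 2) ^ 3"
  proof -
    have "(Y 1 - w * Y 2) ^ 3 - (Y 1 - v * Y 2) ^ 3 = - 3 * (w - v) * (Y 1 ^ 2 * Y 2)
      + 3 * (w ^ 2 - v ^ 2) * (Y 1 * Y 2 ^ 2) - (w ^ 3 - v ^ 3) * Y 2 ^ 3" for v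
      by (simp add: power2_eq_square power3_eq_cube algebra_simps)
    from this[of "w ^ 2"] show ?thesis unfolding w3 w4 w6 by (simp add: algebra_simps)
  qed
  finally have Y: "Y 1 ^ 3 + Y 2 ^ 3 + Y 3 ^ 3 =
    Const A * ((Y 1 - w * Y 2) ^ 3 - (Y 1 - w ^ 2 * Y 2) ^ 3)" .
  have "symmetric_cubic 3 (2 * a, - 3 * a, a) = (\<Sum>j=1..3. Const (a / 3) * Y j ^ 3)"
    using symmetric_cubic_curve_C[of 3 a "-1"] by (simp add: Y_def mult.commute)
  also have "\<dots> = Const (a / 3) * (Y 1 ^ 3 + Y 2 ^ 3 + Y 3 ^ 3)"
    by (simp add: numeral_3_eq_3 numeral_2_eq_2 algebra_simps)
  also have "\<dots> = Const (a / 3 * A) * (Y 1 - Const \<omega> * Y 2) ^ 3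
    + Const (- (a / 3 * A)) * (Y 1 - Const (\<omega> ^ 2) * Y 2) ^ 3"
    unfolding Y Const_mult Const_uminus Const_power w_def by (simp add: algebra_simps)
  finally show ?thesis
    using is_waring_sum_add[OF is_waring_sum_Const_mult_power is_waring_sum_Const_mult_power,
        of 3 "Y 1 - Const \<omega> * Y 2" 3 "Y 1 - Const (\<omega> ^ 2) * Y 2"]
    by (simp add: lin linear_form_diff linear_form_Const_mult numeral_2_eq_2)
qed

text \<open>The Helmert vectors (1, ..., 1, -k, 0, ..., 0) are orthogonal to each other and to (1,
  ..., 1); the coefficients are the reciprocals of the squared lengths k(k + 1) and m.\<close>

lemma power_sum_2_eq_Helmert:
  assumes "m \<ge> 1"
  shows "(power_sum m 2 :: 'a::field_char_0 mpoly) = Const (1 / of_nat m) * power_sum m 1 ^ 2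
    + (\<Sum>k=1..<m. Const (1 / (of_nat k * of_nat (k + 1))) * (power_sum k 1 - of_nat k * Var (k + 1)) ^ 2)"
  using assms
proof (induction m rule: nat_induct_at_least)
  case base
  then show ?case by (simp add: power_sum_def Const_1)
next
  case (Suc m)
  let ?x = "Var (m + 1) :: 'a mpoly" and ?p = "power_sum m 1 :: 'a mpoly" and ?m = "of_nat m :: 'a mpoly"
  \<comment> \<open>The induction step needs only the relations 1/m = \<alpha> + \<beta>, \<beta> m
    = \<alpha> and \<alpha> + \<alpha> m = 1.\<close>
  define \<alpha> \<beta> :: "'a mpoly" where "\<alpha> = Const (1 / of_nat (Suc m))"
    and "\<beta> = Const (1 / (of_nat m * of_nat (m + 1)))"
  have nz: "of_nat m \<noteq> (0::'a)" "of_nat (Suc m) \<noteq> (0::'a)" "1 + of_nat m \<noteq> (0::'a)"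
    using Suc.hyps of_nat_neq_0[of m, where 'a='a] by auto
  have 1: "Const (1 / of_nat m) = \<alpha> + \<beta>"
  proof -
    have "1 / (1 + x) + 1 / (x * (1 + x)) = (1 + x) / (x * (1 + x))" if "x \<noteq> 0" for x :: 'a
      using that by (simp add: add_divide_distrib add.commute)
    then have "1 / (1 + x) + 1 / (x * (1 + x)) = 1 / x" if "x \<noteq> 0" "1 + x \<noteq> 0" for x :: 'a
      using that by simp
    from this[OF nz(1,3)] show ?thesis
      unfolding \<alpha>_def \<beta>_def Const_add[symmetric] by (simp add: add.commute)
  qed
  have 2: "\<beta> * ?m = \<alpha>"
    unfolding \<alpha>_def \<beta>_def Const_of_nat[symmetric] Const_mult[symmetric] using nz by simp
  have 3: "\<alpha> + \<alpha> * ?m = 1"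
    unfolding \<alpha>_def Const_of_nat[symmetric] Const_mult[symmetric] Const_add[symmetric]
    using nz by (simp add: Const_1 flip: add_divide_distrib)
  have "(\<alpha> + \<beta>) * ?p ^ 2 + ?x ^ 2 = \<alpha> * (?p + ?x) ^ 2 + \<beta> * (?p - ?m * ?x) ^ 2"
  proof -
    have "\<beta> * (?p - ?m * ?x) ^ 2 = \<beta> * ?p ^ 2 - 2 * (\<beta> * ?m) * ?p * ?x + (\<beta> * ?m) * ?m * ?x ^ 2"
      by (simp add: power2_eq_square algebra_simps)
    moreover have "?x ^ 2 = (\<alpha> + \<alpha> * ?m) * ?x ^ 2" by (simp add: 3)
    ultimately show ?thesis unfolding 2 by (simp add: power2_eq_square algebra_simps)
  qed
  moreover have "power_sum (Suc m) 1 = ?p + ?x" "power_sum (Suc m) 2 = power_sum m 2 + ?x ^ 2"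
    by (simp_all add: power_sum_def)
  ultimately show ?case
    using Suc by (simp add: 1 \<alpha>_def \<beta>_def algebra_simps del: of_nat_Suc)
qed

text \<open>In (gU + vH)^3 + (gU - vH)^3 the odd powers of H cancel, leaving 2 g^3 U^3 + 6 g v^2 U
  H^2. Solving for \<open>v\<close> requires \<open>g \<noteq> 0\<close>, hence
  \<open>c \<noteq> 0\<close>.\<close>

lemma is_waring_sum_two_cubes:
  fixes c d :: "'a::{alg_closed_field, field_char_0}"
  assumes "c \<noteq> 0" "linear_form n U" "linear_form n H"
  shows "is_waring_sum n 3 2 (Const c * U ^ 3 + Const d * (U * H ^ 2))"
proof -
  obtain g :: 'a where g: "g ^ 3 = c / 2" using nth_root_exists[of 3 "c / 2"] by (metis zero_less_numeral)
  then have "g \<noteq> 0" using assms(1) by auto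
  obtain v :: 'a where v: "v ^ 2 = d / (6 * g)" using nth_root_exists[of 2 "d / (6 * g)"] by (metis zero_less_numeral)
  have "Const c = 2 * Const g ^ 3" "Const d = 6 * Const g * Const v ^ 2"
    using \<open>g \<noteq> 0\<close> by (simp_all add: g v flip: Const_power Const_numeral Const_mult)
  then have "Const c * U ^ 3 + Const d * (U * H ^ 2) =
    (Const g * U + Const v * H) ^ 3 + (Const g * U - Const v * H) ^ 3"
    by (simp add: power2_eq_square power3_eq_cube algebra_simps)
  moreover have "is_waring_sum n 3 (1 + 1) \<dots>"
    by (intro is_waring_sum_add is_waring_sum_power linear_form_add linear_form_diff
        linear_form_Const_mult assms)
  ultimately show ?thesis by (simp add: numeral_2_eq_2)
qed

text \<open>Distributes the coefficient of p_1^3 over the n - 1 binary cubics, each of which must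
  receive a nonzero share.\<close>

lemma exists_nonzero_summands:
  fixes n :: nat
  assumes "n \<ge> 3"
  shows "\<exists>f. (\<forall>k\<in>{1..<n}. f k \<noteq> 0) \<and> (\<Sum>k=1..<n. f k) = (s :: 'a::field_char_0)"
proof -
  obtain t :: 'a where t: "t \<noteq> 0" "s - of_nat (n - 2) * t \<noteq> 0"
  \<comment> \<open>All shares but the first equal \<open>t\<close>. The choice 1 fails only for s =
    n - 2, and then 2 leaves the remainder -s, which is nonzero.\<close>
  proof (cases "s = of_nat (n - 2)")
    case True
    have "of_nat (n - 2) \<noteq> (0::'a)" using assms by (subst of_nat_eq_0_iff) simp
    with True have "s \<noteq> 0" by metis
    moreover have "s - s * 2 = - s" by simp
    ultimately have "s - of_nat (n - 2) * 2 \<noteq> 0" using True by (metis neg_equal_0_iff_equal)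
    then show thesis by (intro that[of 2]) simp_all
  next
    case False
    then show thesis by (intro that[of 1]) auto
  qed
  let ?f = "\<lambda>k. if k = (1::nat) then s - of_nat (n - 2) * t else t"
  have "{1..<n} = insert 1 {2..<n}" using assms by auto
  moreover have "(\<Sum>k\<in>insert 1 {2..<n}. ?f k) = s - of_nat (n - 2) * t + (\<Sum>k=2..<n. t)"
    by (subst sum.insert) (auto intro!: sum.cong)
  ultimately have "(\<Sum>k=1..<n. ?f k) = s" by simp
  with t show ?thesis by (intro exI[of _ ?f]) auto
qed

lemma is_waring_sum_line_2:
  fixes a0 a1 :: "'a::{alg_closed_field, field_char_0}"
  assumes "n \<ge> 3"
  shows "is_waring_sum n 3 (2 * (n - 1)) (symmetric_cubic n (a0, a1, 0))"
proof -
  let ?p = "power_sum n 1 :: 'a mpoly"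
  define h :: "nat \<Rightarrow> 'a mpoly" where "h k = power_sum k 1 - of_nat k * Var (k + 1)" for k
  define d :: "nat \<Rightarrow> 'a" where "d k = 1 / (of_nat k * of_nat (k + 1))" for k
  \<comment> \<open>After the Helmert expansion of p_2 the total coefficient of p_1^3 is
    \<open>a0 + a1\<close>.\<close>
  obtain f where f: "\<And>k. k \<in> {1..<n} \<Longrightarrow> f k \<noteq> 0" "(\<Sum>k=1..<n. f k) = a0 + a1"
    using exists_nonzero_summands[OF assms, of "a0 + a1"] by blast
  have lin: "linear_form n (h k)" if "k \<in> {1..<n}" for k
    unfolding h_def Const_of_nat[symmetric] using that
    by (intro linear_form_diff linear_form_power_sum_1 linear_form_Const_mult linear_form_Var) auto
  have n: "Const (a1 * of_nat n) * Const (1 / of_nat n) = Const a1"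
    using assms by (simp flip: Const_mult)
  have p2: "power_sum n 2 = Const (1 / of_nat n) * ?p ^ 2 + (\<Sum>k=1..<n. Const (d k) * h k ^ 2)"
    unfolding h_def d_def using assms by (intro power_sum_2_eq_Helmert) simp
  have "symmetric_cubic n (a0, a1, 0) =
    Const a0 * ?p ^ 3 + Const (a1 * of_nat n) * ?p * power_sum n 2"
    by (simp add: symmetric_cubic_def Const_0)
  also have "\<dots> = Const a0 * ?p ^ 3 + Const (a1 * of_nat n) * Const (1 / of_nat n) * ?p ^ 3
    + Const (a1 * of_nat n) * ?p * (\<Sum>k=1..<n. Const (d k) * h k ^ 2)"
    unfolding p2 by (simp add: power2_eq_square power3_eq_cube algebra_simps)
  also have "\<dots> = Const (a0 + a1) * ?p ^ 3 + Const (a1 * of_nat n) * ?p * (\<Sum>k=1..<n. Const (d k) * h k ^ 2)"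
    unfolding n by (simp add: Const_add algebra_simps)
  also have "\<dots> = (\<Sum>k=1..<n. Const (f k) * ?p ^ 3 + Const (a1 * of_nat n * d k) * (?p * h k ^ 2))"
    unfolding f(2)[symmetric] Const_sum sum.distrib
    by (simp add: sum_distrib_left sum_distrib_right Const_mult mult_ac)
  finally have eq: "symmetric_cubic n (a0, a1, 0) =
    (\<Sum>k=1..<n. Const (f k) * ?p ^ 3 + Const (a1 * of_nat n * d k) * (?p * h k ^ 2))" .
  have "is_waring_sum n 3 (card {1..<n} * 2) (symmetric_cubic n (a0, a1, 0))"
    unfolding eq
    by (intro is_waring_sum_sum is_waring_sum_two_cubes linear_form_power_sum_1 lin f(1)) simp_all
  then show ?thesis by (simp add: mult.commute)
qed

section \<open>Exact ranks from matching bounds\<close>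

lemma is_waring_sum_imp_cubic_decomposition:
  fixes a0 a1 a2 :: "'a::field_char_0"
  assumes "n \<ge> 3" "is_waring_sum n 3 r (symmetric_cubic n (a0, a1, a2))"
  obtains c where "cubic_decomposition n r a0 a1 a2 c"
proof -
  obtain L where L: "\<forall>i\<in>{1..r}. linear_form n (L i)"
    "symmetric_cubic n (a0, a1, a2) = (\<Sum>i=1..r. L i ^ 3)"
    using assms(2) unfolding is_waring_sum_def by blast
  then obtain c where c: "\<And>i. i \<in> {1..r} \<Longrightarrow> L i = (\<Sum>j=1..n. Const (c i j) * Var j)"
    unfolding linear_form_def by metis
  have "mpoly_eval u (symmetric_cubic n (a0, a1, a2)) = (\<Sum>i=1..r. (\<Sum>j=1..n. c i j * u j) ^ 3)" for u
    unfolding L(2) mpoly_eval_sum mpoly_eval_power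
    by (rule sum.cong) (simp_all add: c mpoly_eval_simps)
  then have "cubic_decomposition n r a0 a1 a2 c"
    using assms(1) unfolding mpoly_eval_symmetric_cubic by unfold_locales auto
  then show thesis by (rule that)
qed

lemma waring_rank_pt_P:
  fixes a0 :: "'a::{alg_closed_field, field_char_0}"
  assumes n: "n \<ge> 3" and "a0 \<noteq> 0"
  shows "waring_rank n 3 (symmetric_cubic n (a0, 0, 0)) = 1"
proof (rule waring_rank_eqI)
  have "symmetric_cubic n (a0, 0, 0) = Const a0 * power_sum n 1 ^ 3"
    by (simp add: symmetric_cubic_def Const_0)
  then show "is_waring_sum n 3 1 (symmetric_cubic n (a0, 0, 0))"
    by (simp only:) (intro is_waring_sum_Const_mult_power linear_form_power_sum_1, simp_all)
next
  fix s assume s: "is_waring_sum n 3 s (symmetric_cubic n (a0, 0, 0))"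
  then obtain c where "cubic_decomposition n s a0 0 0 c"
    using is_waring_sum_imp_cubic_decomposition[OF n] by blast
  \<comment> \<open>At (1, ..., 1) the form takes the value a0 n^3, which is nonzero, so the
    decomposition is not empty.\<close>
  from cubic_decomposition.cubes[OF this, of "\<lambda>_. 1"] show "1 \<le> s"
    using assms n by (cases s) auto
qed

lemma waring_rank_line_2:
  fixes a0 a1 :: "'a::{alg_closed_field, field_char_0}"
  assumes n: "n \<ge> 3" and "a1 \<noteq> 0"
  shows "waring_rank n 3 (symmetric_cubic n (a0, a1, 0)) = 2 * (n - 1)"
proof (rule waring_rank_eqI[OF is_waring_sum_line_2[OF n]])
  fix s assume "is_waring_sum n 3 s (symmetric_cubic n (a0, a1, 0))"
  then obtain c where "cubic_decomposition n s a0 a1 0 c"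
    using is_waring_sum_imp_cubic_decomposition[OF n] by blast
  then show "2 * (n - 1) \<le> s"
    using assms by (auto dest: cubic_decomposition.line_2_lower_bound)
qed

lemma is_waring_sum_lower_bound:
  fixes a b e :: "'a::field_char_0"
  assumes n: "n \<ge> 3" and a: "a \<noteq> 0"
    and F: "is_waring_sum n 3 r (symmetric_cubic n (a * (3 * b ^ 2 + b ^ 3) + e, 3 * a * b, a))"
  shows "e \<noteq> 0 \<or> b \<noteq> -1 \<Longrightarrow> r \<ge> n" "e \<noteq> 0 \<Longrightarrow> b \<noteq> -1 \<or> n \<ge> 4 \<Longrightarrow> r \<ge> n + 1"
proof -
  obtain c where c: "cubic_decomposition n r (a * (3 * b ^ 2 + b ^ 3) + e) (3 * a * b) a c"
    using is_waring_sum_imp_cubic_decomposition[OF n F] by blast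
  interpret d: cubic_decomposition_off_line_2 n r "a * (3 * b ^ 2 + b ^ 3) + e" "3 * a * b" a c
    using c a by (simp add: cubic_decomposition_off_line_2_def cubic_decomposition_off_line_2_axioms_def)
  have b: "d.b = b" using a by (simp add: d.b_def)
  have e: "d.e = e" by (simp add: d.e_def b)
  show 1: "r \<ge> n" if "e \<noteq> 0 \<or> b \<noteq> -1" using d.rank_ge that by (simp add: b e)
  show "r \<ge> n + 1" if "e \<noteq> 0" "b \<noteq> -1 \<or> n \<ge> 4"
    using d.rank_ne 1 that by (simp add: b e)
qed

lemma waring_rank_off_line_2:
  fixes a b e :: "'a::{alg_closed_field, field_char_0}"
  assumes n: "n \<ge> 3" and a: "a \<noteq> 0"
  shows "waring_rank n 3 (symmetric_cubic n (a * (3 * b ^ 2 + b ^ 3) + e, 3 * a * b, a)) =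
    (if n = 3 \<and> b = -1 \<and> e = 0 then n - 1
     else if e = 0 \<or> n = 3 \<and> b = -1 then n
     else n + 1)"
proof -
  let ?F = "\<lambda>e. symmetric_cubic n (a * (3 * b ^ 2 + b ^ 3) + e, 3 * a * b, a)"
  have F_add: "?F e = ?F 0 + Const e * power_sum n 1 ^ 3" for e
    using symmetric_cubic_add_cube[of n "a * (3 * b ^ 2 + b ^ 3)" e] by simp
  have add: "is_waring_sum n 3 (s + 1) (?F e)" if "is_waring_sum n 3 s (?F 0)" for s e
    unfolding F_add[of e]
    by (intro is_waring_sum_add that is_waring_sum_Const_mult_power linear_form_power_sum_1) simp_all
  have F0: "is_waring_sum n 3 n (?F 0)"
    using is_waring_sum_curve_C[of n a b] n by simp
  have Q: "is_waring_sum n 3 (n - 1) (?F 0)" if "n = 3" "b = -1"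
    using is_waring_sum_pt_Q[of a] that by (simp add: mult.commute)
  note lower = is_waring_sum_lower_bound[OF n a, of _ b]
  consider "n = 3" "b = -1" "e = 0" | "e = 0" "b \<noteq> -1" | "e = 0" "b = -1" "n \<ge> 4"
    | "n = 3" "b = -1" "e \<noteq> 0" | "e \<noteq> 0" "b \<noteq> -1 \<or> n \<ge> 4"
    using n by linarith
  then show ?thesis
  proof cases
    case 1
    \<comment> \<open>The form at Q is degenerate, so one cube is added and the bound
      \<open>n\<close> for \<open>?F 1\<close> is used.\<close>
    have "n - 1 \<le> s" if "is_waring_sum n 3 s (?F 0)" for s
      using lower(1)[OF add[OF that, of 1]] by simp
    with Q 1 have "waring_rank n 3 (?F 0) = n - 1" by (intro waring_rank_eqI) auto
    with 1 show ?thesis by simp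
  next
    case 2
    have "n \<le> s" if "is_waring_sum n 3 s (?F 0)" for s
      using lower(1)[OF that] 2 by simp
    with F0 have "waring_rank n 3 (?F 0) = n" by (intro waring_rank_eqI) auto
    with 2 show ?thesis by simp
  next
    case 3
    \<comment> \<open>Again through \<open>?F 1\<close>, whose rank is at least n + 1 because n
      \<ge> 4.\<close>
    have "n \<le> s" if "is_waring_sum n 3 s (?F 0)" for s
      using lower(2)[OF add[OF that, of 1]] 3 by simp
    with F0 have "waring_rank n 3 (?F 0) = n" by (intro waring_rank_eqI) auto
    with 3 show ?thesis by simp
  next
    case 4
    have "n \<le> s" if "is_waring_sum n 3 s (?F e)" for s
      using lower(1)[OF that] 4 by simp
    \<comment> \<open>Two cubes for Q and one multiple of p_1^3 make three, which is n.\<close>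
    moreover have "is_waring_sum n 3 n (?F e)" using add[OF Q, of e] 4 by simp
    ultimately have "waring_rank n 3 (?F e) = n" by (intro waring_rank_eqI)
    with 4 show ?thesis by simp
  next
    case 5
    have "n + 1 \<le> s" if "is_waring_sum n 3 s (?F e)" for s
      using lower(2)[OF that] 5 by simp
    with add[OF F0] have "waring_rank n 3 (?F e) = n + 1" by (intro waring_rank_eqI)
    with 5 show ?thesis by auto
  qed
qed

section \<open>Points of the projective plane\<close>

lemma proj_pt_eq_iff:
  "proj_pt (a0, a1, a2) = proj_pt (b0, b1, b2) \<longleftrightarrow>
    (\<exists>c. c \<noteq> 0 \<and> a0 = c * b0 \<and> a1 = c * b1 \<and> a2 = c * (b2 :: 'a::field))"
proof
  assume "proj_pt (a0, a1, a2) = proj_pt (b0, b1, b2)"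
  moreover have "(a0, a1, a2) \<in> proj_pt (a0, a1, a2)"
    unfolding proj_pt_def by (auto intro: exI[of _ 1])
  ultimately show "\<exists>c. c \<noteq> 0 \<and> a0 = c * b0 \<and> a1 = c * b1 \<and> a2 = c * b2"
    by (auto simp: proj_pt_def)
next
  assume "\<exists>c. c \<noteq> 0 \<and> a0 = c * b0 \<and> a1 = c * b1 \<and> a2 = c * b2"
  then obtain c where c: "c \<noteq> 0" "a0 = c * b0" "a1 = c * b1" "a2 = c * b2" by blast
  have "\<exists>d'. d' \<noteq> 0 \<and> d * b0 = d' * a0 \<and> d * b1 = d' * a1 \<and> d * b2 = d' * a2" if "d \<noteq> 0" for d
    using that c by (intro exI[of _ "d / c"]) simp
  moreover have "\<exists>d'. d' \<noteq> 0 \<and> d * a0 = d' * b0 \<and> d * a1 = d' * b1 \<and> d * a2 = d' * b2" if "d \<noteq> 0" for d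
    using that c by (intro exI[of _ "d * c"]) simp
  ultimately show "proj_pt (a0, a1, a2) = proj_pt (b0, b1, b2)"
    unfolding proj_pt_def by auto
qed

lemma proj_pt_eq_pt_P_iff:
  assumes "(a0, a1, a2) \<noteq> (0, 0, 0)"
  shows "proj_pt (a0, a1, a2) = pt_P \<longleftrightarrow> a1 = 0 \<and> a2 = 0"
  using assms by (auto simp: pt_P_def proj_pt_eq_iff)

lemma proj_pt_in_line_1_iff:
  assumes "(a0, a1, a2) \<noteq> (0, 0, 0)"
  shows "proj_pt (a0, a1, a2) \<in> line_1 \<longleftrightarrow> a1 + 3 * a2 = 0"
proof
  assume "proj_pt (a0, a1, a2) \<in> line_1"
  then obtain b0 b1 b2 where "b1 + 3 * b2 = 0" "proj_pt (a0, a1, a2) = proj_pt (b0, b1, b2)"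
    unfolding line_1_def by blast
  then obtain c where "a1 = c * b1" "a2 = c * b2" by (auto simp: proj_pt_eq_iff)
  then have "a1 + 3 * a2 = c * (b1 + 3 * b2)" by (simp add: algebra_simps)
  with \<open>b1 + 3 * b2 = 0\<close> show "a1 + 3 * a2 = 0" by simp
next
  show "a1 + 3 * a2 = 0 \<Longrightarrow> proj_pt (a0, a1, a2) \<in> line_1"
    using assms unfolding line_1_def by blast
qed

lemma proj_pt_in_line_2_iff:
  assumes "(a0, a1, a2) \<noteq> (0, 0, 0)"
  shows "proj_pt (a0, a1, a2) \<in> line_2 \<longleftrightarrow> a2 = 0"
proof
  assume "proj_pt (a0, a1, a2) \<in> line_2"
  then obtain b0 b1 where "proj_pt (a0, a1, a2) = proj_pt (b0, b1, 0)"
    unfolding line_2_def by blast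
  then show "a2 = 0" by (auto simp: proj_pt_eq_iff)
next
  show "a2 = 0 \<Longrightarrow> proj_pt (a0, a1, a2) \<in> line_2"
    using assms unfolding line_2_def by blast
qed

text \<open>\<alpha> = 0 yields only P; elsewhere \<alpha> scales to 1 and \<beta> becomes a1/(3
  a2), which leaves one condition on a0.\<close>

lemma proj_pt_in_curve_C_iff:
  fixes a0 a1 a2 :: "'a::field_char_0"
  assumes "(a0, a1, a2) \<noteq> (0, 0, 0)"
  shows "proj_pt (a0, a1, a2) \<in> curve_C \<longleftrightarrow>
    (if a2 = 0 then a1 = 0 else a0 = a2 * (3 * (a1 / (3 * a2)) ^ 2 + (a1 / (3 * a2)) ^ 3))"
proof
  assume "proj_pt (a0, a1, a2) \<in> curve_C"
  then obtain \<alpha> \<beta> c where c: "c \<noteq> 0" "a0 = c * (3 * \<alpha> * \<beta>^2 + \<beta>^3)" "a1 = c * (3 * \<alpha>^2 * \<beta>)" "a2 = c * \<alpha>^3"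
    unfolding curve_C_def by (auto simp: proj_pt_eq_iff)
  show "if a2 = 0 then a1 = 0 else a0 = a2 * (3 * (a1 / (3 * a2)) ^ 2 + (a1 / (3 * a2)) ^ 3)"
  proof (cases "\<alpha> = 0")
    case True
    then show ?thesis using c by simp
  next
    case False
    then have "a1 / (3 * a2) = \<beta> / \<alpha>" using c by (simp add: field_simps power2_eq_square power3_eq_cube)
    then show ?thesis using c False by (simp add: field_simps power2_eq_square power3_eq_cube)
  qed
next
  assume *: "if a2 = 0 then a1 = 0 else a0 = a2 * (3 * (a1 / (3 * a2)) ^ 2 + (a1 / (3 * a2)) ^ 3)"
  show "proj_pt (a0, a1, a2) \<in> curve_C"
  proof (cases "a2 = 0")
    case True
    then have "proj_pt (a0, a1, a2) = proj_pt (3 * 0 * 1^2 + 1^3, 3 * 0^2 * 1, 0^3)"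
      unfolding proj_pt_eq_iff using * assms by (intro exI[of _ a0]) auto
    moreover have "(0::'a, 1::'a) \<noteq> (0, 0)" by simp
    ultimately show ?thesis unfolding curve_C_def by blast
  next
    case False
    define \<beta> where "\<beta> = a1 / (3 * a2)"
    have "a0 = a2 * (3 * \<beta> ^ 2 + \<beta> ^ 3)" "a1 = a2 * (3 * \<beta>)"
      using * False by (simp_all add: \<beta>_def)
    then have "proj_pt (a0, a1, a2) = proj_pt (3 * 1 * \<beta>^2 + \<beta>^3, 3 * 1^2 * \<beta>, 1^3)"
      unfolding proj_pt_eq_iff using False by (intro exI[of _ a2]) auto
    moreover have "(1::'a, \<beta>) \<noteq> (0, 0)" by simp
    ultimately show ?thesis unfolding curve_C_def by blast
  qed
qed

theorem proposition4p5:
  fixes a0 a1 a2 :: "'k::field_char_0" and n :: nat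
  assumes "n \<ge> 3" and "(a0, a1, a2) \<noteq> (0, 0, 0)"
  shows "geometric_waring_rank n 3 (symmetric_cubic n (a0, a1, a2)) =
    (let p = proj_pt (a0, a1, a2) in
      if p = pt_P then 1
      else if n = 3 \<and> p = pt_Q then n - 1
      else if p \<in> curve_C - {pt_P} \<or> (n = 3 \<and> p \<in> line_1 - {pt_Q}) then n
      else if p \<in> line_2 - {pt_P} then 2 * (n - 1)
      else n + 1)"
proof (cases "a2 = 0")
  case True
  \<comment> \<open>On a2 = 0 the curve and the line a1 + 3 a2 = 0 both meet only P, so just the
    ranks 1 and 2(n - 1) occur.\<close>
  have "proj_pt (a0, a1, a2) \<noteq> pt_Q" using True by (auto simp: pt_Q_def proj_pt_eq_iff)
  then show ?thesis
    using True assms waring_rank_pt_P[of n "to_ac a0"] waring_rank_line_2[of n "to_ac a1" "to_ac a0"]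
    by (auto simp: geometric_waring_rank_def base_change_to_ac_symmetric_cubic
        proj_pt_eq_pt_P_iff proj_pt_in_curve_C_iff proj_pt_in_line_1_iff proj_pt_in_line_2_iff Let_def)
next
  case False
  define b where "b = a1 / (3 * a2)"
  define e where "e = a0 - a2 * (3 * b ^ 2 + b ^ 3)"
  have a1: "a1 = 3 * a2 * b" using False by (simp add: b_def)
  have a0: "a0 = a2 * (3 * b ^ 2 + b ^ 3) + e" by (simp add: e_def)
  have "geometric_waring_rank n 3 (symmetric_cubic n (a0, a1, a2)) = waring_rank n 3
    (symmetric_cubic n (to_ac a2 * (3 * to_ac b ^ 2 + to_ac b ^ 3) + to_ac e, 3 * to_ac a2 * to_ac b, to_ac a2))"
    unfolding geometric_waring_rank_def base_change_to_ac_symmetric_cubic by (simp add: a0 a1)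
  also have "\<dots> = (if n = 3 \<and> to_ac b = -1 \<and> to_ac e = 0 then n - 1
     else if to_ac e = 0 \<or> n = 3 \<and> to_ac b = -1 then n else n + 1)"
    using assms(1) False by (intro waring_rank_off_line_2) simp_all
  \<comment> \<open>Injectivity of \<open>to_ac\<close> brings the case conditions back to the
    ground field.\<close>
  also have "to_ac b = -1 \<longleftrightarrow> b = -1" by (metis to_ac_1 to_ac_eq_iff to_ac_minus)
  finally have rank: "geometric_waring_rank n 3 (symmetric_cubic n (a0, a1, a2)) =
    (if n = 3 \<and> b = -1 \<and> e = 0 then n - 1 else if e = 0 \<or> n = 3 \<and> b = -1 then n else n + 1)"
    by simp
  have P: "proj_pt (a0, a1, a2) \<noteq> pt_P" using False assms(2) by (simp add: proj_pt_eq_pt_P_iff)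
  have Q: "proj_pt (a0, a1, a2) = pt_Q \<longleftrightarrow> b = -1 \<and> e = 0"
  proof
    assume "proj_pt (a0, a1, a2) = pt_Q"
    then have "a0 = 2 * a2" "a1 = - 3 * a2" by (auto simp: pt_Q_def proj_pt_eq_iff)
    then show "b = -1 \<and> e = 0" using False by (simp add: b_def e_def)
  next
    assume "b = -1 \<and> e = 0"
    then show "proj_pt (a0, a1, a2) = pt_Q"
      unfolding pt_Q_def proj_pt_eq_iff using False a0 a1 by (intro exI[of _ a2]) auto
  qed
  have C: "proj_pt (a0, a1, a2) \<in> curve_C \<longleftrightarrow> e = 0"
    unfolding proj_pt_in_curve_C_iff[OF assms(2)] b_def[symmetric] using False by (simp add: e_def)
  have "a1 + 3 * a2 = 3 * a2 * (b + 1)" by (simp add: a1 algebra_simps)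
  then have "proj_pt (a0, a1, a2) \<in> line_1 \<longleftrightarrow> b = -1"
    unfolding proj_pt_in_line_1_iff[OF assms(2)] using False by (simp add: eq_neg_iff_add_eq_0)
  moreover have "proj_pt (a0, a1, a2) \<notin> line_2"
    using False assms(2) by (simp add: proj_pt_in_line_2_iff)
  ultimately show ?thesis
    unfolding rank Let_def using P Q C by auto
qed

end
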